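(* Let $n\ge2$, let $\mathscr C_+$ be the space of smooth functions on $\mathbb R^n\setminus\{0\}$ with bounded support, and let $\mathscr C_-$ be the space of smooth functions on $(\mathbb R^n)^*\setminus\{0\}$ supported away from a neighborhood of $0$. The operator $\mathscr M:\mathscr C_+\to\mathscr C_-$ defined by $$\mathscr Mf(\xi)=\int_{\langle\xi,x\rangle=1}f(x)\,d\mu_\xi$$ is not surjective.
   Context: Functions are complex valued, and no $O(n)$-finiteness is assumed. "Bounded support" means the support is bounded in $\mathbb R^n$ (it may accumulate at $0$). For $\xi\in(\mathbb R^n)^*\setminus\{0\}$, $d\mu_\xi$ is the measure on the hyperplane $\{x\in\mathbb R^n:\langle\xi,x\rangle=t\}$ such that $d\mu_\xi\,dt=dx$, where $dx$ is Lebesgue measure on $\mathbb R^n$ and $dt$ is Lebesgue measure on $\mathbb R$. *)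

theory Defs
  imports "HOL-Analysis.Analysis"
begin

text \<open>
  The dual of \<open>\<real>\<^sup>n\<close> is identified with \<open>\<real>\<^sup>n\<close> through the dual of the standard basis, so that
  the pairing \<open>\<langle>\<xi>, x\<rangle>\<close> is the inner product \<open>\<xi> \<bullet> x\<close>.
\<close>

text \<open>
  \<open>C\<^sup>k\<close> regularity, intended for open \<open>S\<close> and finite-dimensional domains; all derivatives are
  real derivatives.
\<close>

primrec Ck_on :: "nat \<Rightarrow> 'a set \<Rightarrow> ('a::real_normed_vector \<Rightarrow> 'b::real_normed_vector) \<Rightarrow> bool" where
  "Ck_on 0 S f \<longleftrightarrow> continuous_on S f"
| "Ck_on (Suc k) S f \<longleftrightarrow>
     f differentiable_on S \<and> (\<forall>v. Ck_on k S (\<lambda>x. frechet_derivative f (at x) v))"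

definition smooth_on :: "'a set \<Rightarrow> ('a::real_normed_vector \<Rightarrow> 'b::real_normed_vector) \<Rightarrow> bool" where
  "smooth_on S f \<longleftrightarrow> (\<forall>k. Ck_on k S f)"

text \<open>
  A function on the punctured space is represented by the total function that extends it by
  \<open>0\<close> at the origin; no regularity is required there.
\<close>

definition C_plus :: "('a::euclidean_space \<Rightarrow> complex) set" where
  "C_plus = {f. f 0 = 0 \<and> smooth_on (- {0}) f \<and> bounded {x. f x \<noteq> 0}}"

definition C_minus :: "('a::euclidean_space \<Rightarrow> complex) set" where
  "C_minus = {g. g 0 = 0 \<and> smooth_on (- {0}) g \<and>
                 (\<exists>U. open U \<and> 0 \<in> U \<and> (\<forall>\<xi>\<in>U. g \<xi> = 0))}"

text \<open>
  For \<open>\<xi> \<noteq> 0\<close>, the measure \<open>d\<mu>\<^sub>\<xi>\<close> on the hyperplane \<open>\<xi> \<bullet> x = t\<close> normalized by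
  \<open>d\<mu>\<^sub>\<xi> dt = dx\<close>: Lebesgue measure on the slab \<open>t \<le> \<xi> \<bullet> x \<le> t + 1\<close>, which has
  \<open>dt\<close>-thickness \<open>1\<close>, is pushed forward along the orthogonal projection onto the hyperplane.
  The lemmas below show that this measure lives on the hyperplane, that it disintegrates
  Lebesgue measure, and that it is equivariant under translations, which together determine
  it for every \<open>t\<close> and not only for almost every \<open>t\<close>.
\<close>

definition hyperplane_measure :: "'a::euclidean_space \<Rightarrow> real \<Rightarrow> 'a measure" where
  "hyperplane_measure \<xi> t =
     distr (restrict_space lborel {x. t \<le> \<xi> \<bullet> x \<and> \<xi> \<bullet> x \<le> t + 1}) borel
       (\<lambda>x. x - ((\<xi> \<bullet> x - t) / (\<xi> \<bullet> \<xi>)) *\<^sub>R \<xi>)"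

definition hyperplane_transform :: "('a::euclidean_space \<Rightarrow> complex) \<Rightarrow> 'a \<Rightarrow> complex" where
  "hyperplane_transform f \<xi> =
     (if \<xi> = 0 then 0 else integral\<^sup>L (hyperplane_measure \<xi> 1) f)"

lemma sets_hyperplane_measure [measurable_cong, simp]:
  "sets (hyperplane_measure \<xi> t) = sets borel"
  by (simp add: hyperplane_measure_def)

lemma space_hyperplane_measure [simp]: "space (hyperplane_measure \<xi> t) = UNIV"
  by (simp add: hyperplane_measure_def)

lemma nn_integral_hyperplane_measure:
  fixes h :: "'a::euclidean_space \<Rightarrow> ennreal"
  assumes [measurable]: "h \<in> borel_measurable borel"
  shows "(\<integral>\<^sup>+x. h x \<partial>hyperplane_measure \<xi> t) =
    (\<integral>\<^sup>+x. indicator {t..t+1} (\<xi> \<bullet> x) * h (x - ((\<xi> \<bullet> x - t) / (\<xi> \<bullet> \<xi>)) *\<^sub>R \<xi>) \<partial>lborel)"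
proof -
  have [measurable]: "{x. t \<le> \<xi> \<bullet> x \<and> \<xi> \<bullet> x \<le> t + 1} \<in> sets borel"
    by measurable
  have [measurable]: "(\<lambda>x. x - ((\<xi> \<bullet> x - t) / (\<xi> \<bullet> \<xi>)) *\<^sub>R \<xi>) \<in> borel_measurable borel"
    by measurable
  have "(\<integral>\<^sup>+x. h x \<partial>hyperplane_measure \<xi> t) =
    (\<integral>\<^sup>+x. h (x - ((\<xi> \<bullet> x - t) / (\<xi> \<bullet> \<xi>)) *\<^sub>R \<xi>)
       \<partial>restrict_space lborel {x. t \<le> \<xi> \<bullet> x \<and> \<xi> \<bullet> x \<le> t + 1})"
    unfolding hyperplane_measure_def
    by (subst nn_integral_distr) (auto intro!: measurable_restrict_space1)
  also have "\<dots> = (\<integral>\<^sup>+x. indicator {t..t+1} (\<xi> \<bullet> x) *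
      h (x - ((\<xi> \<bullet> x - t) / (\<xi> \<bullet> \<xi>)) *\<^sub>R \<xi>) \<partial>lborel)"
    by (subst nn_integral_restrict_space) (auto intro!: nn_integral_cong simp: indicator_def)
  finally show ?thesis .
qed

lemma AE_hyperplane_measure:
  fixes \<xi> :: "'a::euclidean_space"
  assumes "\<xi> \<noteq> 0"
  shows "AE x in hyperplane_measure \<xi> t. \<xi> \<bullet> x = t"
proof -
  have [measurable]: "{x. t \<le> \<xi> \<bullet> x \<and> \<xi> \<bullet> x \<le> t + 1} \<in> sets borel"
    by measurable
  have [measurable]: "(\<lambda>x. x - ((\<xi> \<bullet> x - t) / (\<xi> \<bullet> \<xi>)) *\<^sub>R \<xi>) \<in> borel_measurable borel"
    by measurable
  show ?thesis
    unfolding hyperplane_measure_def using assms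
    by (subst AE_distr_iff) (auto intro!: measurable_restrict_space1 simp: inner_diff_right)
qed

lemma nn_integral_lborel_shift:
  fixes h :: "'a::euclidean_space \<Rightarrow> ennreal"
  assumes [measurable]: "h \<in> borel_measurable borel"
  shows "(\<integral>\<^sup>+x. h (v + x) \<partial>lborel) = (\<integral>\<^sup>+x. h x \<partial>lborel)"
  by (subst (2) lborel_distr_plus [of v, symmetric]) (simp add: nn_integral_distr)

lemma nn_integral_hyperplane_measure_disintegration:
  fixes h :: "'a::euclidean_space \<Rightarrow> ennreal"
  assumes "\<xi> \<noteq> 0" and [measurable]: "h \<in> borel_measurable borel"
  shows "(\<integral>\<^sup>+t. (\<integral>\<^sup>+x. h x \<partial>hyperplane_measure \<xi> t) \<partial>lborel) = (\<integral>\<^sup>+x. h x \<partial>lborel)"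
proof -
  define w where "w = \<xi> /\<^sub>R (\<xi> \<bullet> \<xi>)"
  have "(\<integral>\<^sup>+t. (\<integral>\<^sup>+x. h x \<partial>hyperplane_measure \<xi> t) \<partial>lborel) =
    (\<integral>\<^sup>+t. (\<integral>\<^sup>+x. indicator {0..1} (\<xi> \<bullet> x - t) * h (x - (\<xi> \<bullet> x - t) *\<^sub>R w) \<partial>lborel) \<partial>lborel)"
    by (auto simp: nn_integral_hyperplane_measure w_def divide_inverse indicator_def
        intro!: nn_integral_cong)
  also have "\<dots> =
    (\<integral>\<^sup>+x. (\<integral>\<^sup>+t. indicator {0..1} (\<xi> \<bullet> x - t) * h (x - (\<xi> \<bullet> x - t) *\<^sub>R w) \<partial>lborel) \<partial>lborel)"
    by (rule lborel_pair.Fubini') measurable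
  also have "\<dots> = (\<integral>\<^sup>+x. (\<integral>\<^sup>+s. indicator {0..1} s * h (x - s *\<^sub>R w) \<partial>lborel) \<partial>lborel)"
  proof (rule nn_integral_cong)
    fix x :: 'a
    show "(\<integral>\<^sup>+t. indicator {0..1} (\<xi> \<bullet> x - t) * h (x - (\<xi> \<bullet> x - t) *\<^sub>R w) \<partial>lborel) =
      (\<integral>\<^sup>+s. indicator {0..1} s * h (x - s *\<^sub>R w) \<partial>lborel)"
      by (subst (2) nn_integral_real_affine [where c = "-1" and t = "\<xi> \<bullet> x"])
        (simp_all add: one_ennreal_def [symmetric])
  qed
  also have "\<dots> = (\<integral>\<^sup>+s. (\<integral>\<^sup>+x. indicator {0..1} s * h (x - s *\<^sub>R w) \<partial>lborel) \<partial>lborel)"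
    by (rule lborel_pair.Fubini') measurable
  also have "\<dots> = (\<integral>\<^sup>+s. indicator {0..1::real} s * (\<integral>\<^sup>+x. h x \<partial>lborel) \<partial>lborel)"
    using nn_integral_lborel_shift [of h "- (_ *\<^sub>R w)"]
    by (simp add: nn_integral_cmult)
  also have "\<dots> = (\<integral>\<^sup>+x. h x \<partial>lborel)"
    by (simp add: nn_integral_multc)
  finally show ?thesis .
qed

lemma distr_hyperplane_measure_translation:
  fixes \<xi> v :: "'a::euclidean_space"
  assumes "\<xi> \<noteq> 0"
  shows "distr (hyperplane_measure \<xi> t) borel (\<lambda>x. v + x) = hyperplane_measure \<xi> (t + \<xi> \<bullet> v)"
proof (rule measure_eqI)
  fix A assume "A \<in> sets (distr (hyperplane_measure \<xi> t) borel (\<lambda>x. v + x))"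
  then have [measurable]: "A \<in> sets borel"
    by simp
  have "emeasure (distr (hyperplane_measure \<xi> t) borel (\<lambda>x. v + x)) A =
    (\<integral>\<^sup>+x. indicator A (v + x) \<partial>hyperplane_measure \<xi> t)"
    by (simp flip: nn_integral_indicator add: nn_integral_distr)
  also have "\<dots> = (\<integral>\<^sup>+x. indicator {t..t+1} (\<xi> \<bullet> x) *
      indicator A (v + (x - ((\<xi> \<bullet> x - t) / (\<xi> \<bullet> \<xi>)) *\<^sub>R \<xi>)) \<partial>lborel)"
    by (rule nn_integral_hyperplane_measure) measurable
  also have "\<dots> = (\<integral>\<^sup>+x. indicator {t + \<xi> \<bullet> v..t + \<xi> \<bullet> v + 1} (\<xi> \<bullet> (v + x)) *
      indicator A ((v + x) - ((\<xi> \<bullet> (v + x) - (t + \<xi> \<bullet> v)) / (\<xi> \<bullet> \<xi>)) *\<^sub>R \<xi>) \<partial>lborel)"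
    by (rule nn_integral_cong) (simp add: inner_add_right indicator_def algebra_simps)
  also have "\<dots> = (\<integral>\<^sup>+x. indicator {t + \<xi> \<bullet> v..t + \<xi> \<bullet> v + 1} (\<xi> \<bullet> x) *
      indicator A (x - ((\<xi> \<bullet> x - (t + \<xi> \<bullet> v)) / (\<xi> \<bullet> \<xi>)) *\<^sub>R \<xi>) \<partial>lborel)"
    by (rule nn_integral_lborel_shift) measurable
  also have "\<dots> = (\<integral>\<^sup>+x. indicator A x \<partial>hyperplane_measure \<xi> (t + \<xi> \<bullet> v))"
    by (rule nn_integral_hyperplane_measure [symmetric]) measurable
  finally show "emeasure (distr (hyperplane_measure \<xi> t) borel (\<lambda>x. v + x)) A =
      emeasure (hyperplane_measure \<xi> (t + \<xi> \<bullet> v)) A"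
    by simp
qed simp

end

theory Submission
  imports Defs
begin

text \<open>
  In polar coordinates, \<open>\<M> f(\<xi>) = \<integral> f(\<omega> / (\<xi> \<bullet> \<omega>)) (\<xi> \<bullet> \<omega>)\<^sup>-\<^sup>n d\<omega>\<close> over
  \<open>\<xi> \<bullet> \<omega> > 0\<close>, an integral over a fixed compact domain. Differentiating in the direction \<open>v\<close> gives
  \<open>\<M> (D\<^sub>v f)\<close> with \<open>D\<^sub>v f(x) = - (v \<bullet> x) (n f(x) + Df(x) x)\<close>, again of bounded support, so
  \<open>\<M> f\<close> is smooth.

  For the failure of surjectivity, let \<open>u\<close> be the slope \<open>x\<^sub>2 / x\<^sub>1\<close>, which is bounded by \<open>A V\<close> on the
  part of the hyperplane \<open>V x\<^sub>1 = 1\<close> in the ball of radius \<open>A\<close>. Since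
  \<open>\<partial>\<^sub>1 \<M> (u\<^sup>j\<^sup>+\<^sup>1 f) = \<partial>\<^sub>2 \<M> (u\<^sup>j f)\<close>, the \<open>m\<close>-th derivative of the moment \<open>\<M> (u\<^sup>m f)\<close> along the
  first axis is \<open>\<partial>\<^sub>2\<^sup>m \<M> f\<close>. The moment grows at most geometrically in \<open>m\<close>, so \<open>\<partial>\<^sub>2\<^sup>m \<M> f\<close>, when of
  one sign along the axis, is at most \<open>m! R\<^sup>m\<close>. A function \<open>\<phi>(\<xi>\<^sub>1) h(\<xi>\<^sub>2)\<close> with \<open>\<phi> \<ge> 0\<close> vanishing
  near \<open>0\<close> and \<open>h\<close> sufficiently non-analytic at \<open>0\<close> is therefore not of the form \<open>\<M> f\<close>.
\<close>

section \<open>Smooth functions\<close>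

lemma Ck_on_SucD: "Ck_on (Suc k) S f \<Longrightarrow> Ck_on k S f"
proof (induction k arbitrary: f)
  case 0
  then show ?case by (simp add: differentiable_imp_continuous_on)
next
  case (Suc k)
  then show ?case by (metis Ck_on.simps(2))
qed

lemma frechet_derivative_cong_open:
  assumes "open S" "x \<in> S" "\<And>y. y \<in> S \<Longrightarrow> f y = g y"
  shows "frechet_derivative f (at x) = frechet_derivative g (at x)"
proof -
  have "(f has_derivative D) (at x) \<longleftrightarrow> (g has_derivative D) (at x)" for D
    using assms by (metis has_derivative_transform_within_open)
  then show ?thesis by (simp add: frechet_derivative_def)
qed

lemma Ck_on_cong:
  assumes "open S" "\<And>x. x \<in> S \<Longrightarrow> f x = g x" "Ck_on k S f"
  shows "Ck_on k S g"
  using assms(2,3)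
proof (induction k arbitrary: f g)
  case 0
  then show ?case by (metis Ck_on.simps(1) continuous_on_cong)
next
  case (Suc k)
  have "g differentiable_on S"
    using Suc.prems unfolding differentiable_on_def Ck_on.simps(2)
    by (metis differentiable_transform_within zero_less_one)
  moreover have "Ck_on k S (\<lambda>x. frechet_derivative g (at x) v)" for v
    by (rule Suc.IH [where f = "\<lambda>x. frechet_derivative f (at x) v"])
       (use Suc.prems frechet_derivative_cong_open [OF assms(1), of _ f g] in auto)
  ultimately show ?case by simp
qed

text \<open>The recursion in \<open>Ck_on\<close> refers to \<open>frechet_derivative\<close>.
  Uniqueness of the derivative lets an explicit family \<open>D\<close> serve instead, which is how
  the closure properties of \<open>Ck_on\<close> below are obtained.\<close>

lemma Ck_on_SucI:
  assumes "open S" "\<And>x. x \<in> S \<Longrightarrow> (f has_derivative D x) (at x)"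
    and "\<And>v. Ck_on k S (\<lambda>x. D x v)"
  shows "Ck_on (Suc k) S f"
proof -
  have "f differentiable_on S"
    using assms(2) by (meson differentiable_at_imp_differentiable_on differentiable_def)
  moreover have "Ck_on k S (\<lambda>x. frechet_derivative f (at x) v)" for v
    by (rule Ck_on_cong [OF assms(1) _ assms(3)[of v]])
       (metis assms(2) frechet_derivative_at)
  ultimately show ?thesis by simp
qed

lemma Ck_on_Suc_has_derivative:
  assumes "Ck_on (Suc k) S f" "open S" "x \<in> S"
  shows "(f has_derivative frechet_derivative f (at x)) (at x)"
  using assms by (metis Ck_on.simps(2) differentiable_on_eq_differentiable_at frechet_derivative_works)

lemma Ck_on_const: "open S \<Longrightarrow> Ck_on k S (\<lambda>x. c)"
proof (induction k arbitrary: c)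
  case (Suc k)
  then show ?case by (intro Ck_on_SucI [where D = "\<lambda>_ _. 0"]) auto
qed simp

lemma Ck_on_add:
  assumes "open S" "Ck_on k S f" "Ck_on k S g"
  shows "Ck_on k S (\<lambda>x. f x + g x)"
  using assms(2,3)
proof (induction k arbitrary: f g)
  case 0
  then show ?case by (simp add: continuous_on_add)
next
  case (Suc k)
  show ?case
    by (rule Ck_on_SucI [OF assms(1), where
          D = "\<lambda>x v. frechet_derivative f (at x) v + frechet_derivative g (at x) v"])
       (use Suc assms(1) in \<open>auto intro!: has_derivative_add intro: Ck_on_Suc_has_derivative\<close>)
qed

lemma Ck_on_scaleR:
  assumes "open S" "Ck_on k S a" "Ck_on k S f"
  shows "Ck_on k S (\<lambda>x. a x *\<^sub>R f x)"
  using assms(2,3)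
proof (induction k arbitrary: a f)
  case 0
  then show ?case by (simp add: continuous_on_scaleR)
next
  case (Suc k)
  have "Ck_on k S (\<lambda>x. a x *\<^sub>R frechet_derivative f (at x) v + frechet_derivative a (at x) v *\<^sub>R f x)" for v
    using Suc.prems Ck_on_SucD [of k S a] Ck_on_SucD [of k S f]
    by (intro Ck_on_add assms(1) Suc.IH) (auto simp del: Ck_on.simps simp: Ck_on.simps(2))
  then show ?case
    by (intro Ck_on_SucI [OF assms(1), where
          D = "\<lambda>x v. a x *\<^sub>R frechet_derivative f (at x) v + frechet_derivative a (at x) v *\<^sub>R f x"])
       (use Suc assms(1) in \<open>auto intro!: has_derivative_scaleR intro: Ck_on_Suc_has_derivative\<close>)
qed

lemma smooth_on_const: "open S \<Longrightarrow> smooth_on S (\<lambda>x. c)"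
  by (simp add: smooth_on_def Ck_on_const)

lemma smooth_on_add: "open S \<Longrightarrow> smooth_on S f \<Longrightarrow> smooth_on S g \<Longrightarrow> smooth_on S (\<lambda>x. f x + g x)"
  by (simp add: smooth_on_def Ck_on_add)

lemma smooth_on_scaleR:
  "open S \<Longrightarrow> smooth_on S a \<Longrightarrow> smooth_on S f \<Longrightarrow> smooth_on S (\<lambda>x. a x *\<^sub>R f x)"
  by (simp add: smooth_on_def Ck_on_scaleR)

lemma smooth_on_sum:
  assumes "open S" "\<And>i. i \<in> I \<Longrightarrow> smooth_on S (f i)"
  shows "smooth_on S (\<lambda>x. \<Sum>i\<in>I. f i x)"
  using assms(2)
  by (induction I rule: infinite_finite_induct) (auto intro: smooth_on_const smooth_on_add assms(1))

lemma smooth_on_cong: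
  "open S \<Longrightarrow> (\<And>x. x \<in> S \<Longrightarrow> f x = g x) \<Longrightarrow> smooth_on S f \<Longrightarrow> smooth_on S g"
  unfolding smooth_on_def using Ck_on_cong by blast

lemma smooth_on_derivative: "smooth_on S f \<Longrightarrow> smooth_on S (\<lambda>x. frechet_derivative f (at x) v)"
  unfolding smooth_on_def by (metis Ck_on.simps(2))

lemma smooth_on_has_derivative:
  "smooth_on S f \<Longrightarrow> open S \<Longrightarrow> x \<in> S \<Longrightarrow> (f has_derivative frechet_derivative f (at x)) (at x)"
  unfolding smooth_on_def using Ck_on_Suc_has_derivative by blast

lemma smooth_on_imp_continuous_on: "smooth_on S f \<Longrightarrow> continuous_on S f"
  unfolding smooth_on_def by (metis Ck_on.simps(1))

text \<open>A derivative of \<open>F j (x \<bullet> e)\<close> in direction \<open>v\<close> is a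
  constant times \<open>F (Suc j) (x \<bullet> e)\<close>, the same shape one level up; hence the
  induction on \<open>k\<close> keeps \<open>j\<close> arbitrary. The rule serves linear forms and
  both factors of the function outside the range.\<close>

lemma smooth_on_derivative_tower_inner:
  fixes e :: "'a::real_inner" and F :: "nat \<Rightarrow> real \<Rightarrow> real"
  assumes "open S" and F: "\<And>k t. (F k has_real_derivative F (Suc k) t) (at t)"
  shows "smooth_on S (\<lambda>x. F j (x \<bullet> e))"
  unfolding smooth_on_def
proof
  fix k show "Ck_on k S (\<lambda>x. F j (x \<bullet> e))"
  proof (induction k arbitrary: j)
    case 0
    have "continuous_on UNIV (F j)"
      using F by (meson DERIV_continuous continuous_at_imp_continuous_on)
    then show ?case
      by (auto intro!: continuous_on_compose2 [of UNIV "F j"] continuous_intros)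
  next
    case (Suc k)
    have "Ck_on k S (\<lambda>x. (v \<bullet> e) *\<^sub>R F (Suc j) (x \<bullet> e))" for v
      by (intro Ck_on_scaleR Ck_on_const Suc assms(1))
    moreover have "((\<lambda>x. F j (x \<bullet> e)) has_derivative (\<lambda>v. (v \<bullet> e) *\<^sub>R F (Suc j) (x \<bullet> e))) (at x)" for x
    proof -
      have "((\<lambda>x. F j (x \<bullet> e)) has_derivative (\<lambda>v. F (Suc j) (x \<bullet> e) * (v \<bullet> e))) (at x)"
        using F [of j "x \<bullet> e"]
        by (intro has_derivative_compose [where f = "\<lambda>x. x \<bullet> e" and g = "F j"])
           (auto simp: has_field_derivative_def intro!: derivative_eq_intros)
      then show ?thesis by (simp add: mult.commute)
    qed
    ultimately show ?case
      by (intro Ck_on_SucI [OF assms(1), where D = "\<lambda>x v. (v \<bullet> e) *\<^sub>R F (Suc j) (x \<bullet> e)"]) auto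
  qed
qed

lemma smooth_on_inner:
  fixes v :: "'a::real_inner"
  assumes "open S" shows "smooth_on S (\<lambda>x. v \<bullet> x)"
proof -
  define F :: "nat \<Rightarrow> real \<Rightarrow> real" where "F k t = (if k = 0 then t else if k = 1 then 1 else 0)" for k t
  have "(F k has_real_derivative F (Suc k) t) (at t)" for k t
    unfolding F_def by (cases "k = 0") (auto intro!: derivative_eq_intros)
  then have "smooth_on S (\<lambda>x. F 0 (x \<bullet> v))"
    by (intro smooth_on_derivative_tower_inner assms)
  then show ?thesis
    by (simp add: F_def inner_commute)
qed

lemma smooth_on_of_real:
  assumes "open S" "smooth_on S f" shows "smooth_on S (\<lambda>x. complex_of_real (f x))"
  using smooth_on_scaleR [OF assms smooth_on_const [OF assms(1), of "1::complex"]]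
  by (simp add: scaleR_conv_of_real)

section \<open>The hyperplane measure in polar coordinates\<close>

text \<open>For \<open>r \<ge> 0\<close> the support is \<open>1 \<le> r \<le> 2\<close>. The factor
  \<open>r\<close> is there to cancel the \<open>1 / t\<close> in the measure \<open>dt / t\<close>,
  and \<open>6\<close> normalizes the integral of \<open>(r - 1) * (2 - r)\<close>, which is
  \<open>1 / 6\<close>. Continuity suffices: the cutoff depends on \<open>x\<close> only, while
  derivatives are taken in \<open>\<xi>\<close>.\<close>

definition radial_cutoff :: "real \<Rightarrow> real" where
  "radial_cutoff r = max 0 (6 * r * (r - 1) * (2 - r))"

lemma radial_cutoff_nonneg: "radial_cutoff r \<ge> 0"
  by (simp add: radial_cutoff_def)

lemma radial_cutoff_eq_0:
  assumes "0 \<le> r" "r \<le> 1 \<or> 2 \<le> r" shows "radial_cutoff r = 0"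
proof -
  have "(r - 1) * (2 - r) \<le> 0"
    using assms mult_nonpos_nonneg [of "r - 1" "2 - r"] mult_nonneg_nonpos [of "r - 1" "2 - r"]
    by linarith
  then have "6 * r * ((r - 1) * (2 - r)) \<le> 0"
    using assms(1) mult_nonneg_nonpos by simp
  then show ?thesis by (simp add: radial_cutoff_def mult.assoc)
qed

lemma continuous_on_radial_cutoff [continuous_intros]:
  "continuous_on S f \<Longrightarrow> continuous_on S (\<lambda>x. radial_cutoff (f x))"
  unfolding radial_cutoff_def by (intro continuous_intros)

lemma borel_measurable_radial_cutoff [measurable]: "radial_cutoff \<in> borel_measurable borel"
  by (intro borel_measurable_continuous_onI continuous_intros)

text \<open>The measure \<open>dt / t\<close> on the positive half-line is invariant under dilation,
  so the value does not depend on \<open>s\<close>.\<close>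

lemma nn_integral_radial_cutoff:
  assumes s: "s > 0"
  shows "(\<integral>\<^sup>+t. indicator {0<..} t * ennreal (radial_cutoff (t * s) / t) \<partial>lborel) = 1"
proof -
  define h where "h t = ennreal (6 * (t - 1) * (2 - t)) * indicator {1..2} t" for t :: real
  have [measurable]: "h \<in> borel_measurable borel" unfolding h_def by measurable
  have "indicator {0<..} t * ennreal (radial_cutoff (t * s) / t) = ennreal s * h (0 + s * t)" for t
  proof (cases "t > 0 \<and> s * t \<in> {1..2}")
    case True
    then have "radial_cutoff (t * s) = 6 * (t * s) * (s * t - 1) * (2 - s * t)"
      using s by (auto simp: radial_cutoff_def mult.commute)
    then have "radial_cutoff (t * s) / t = s * (6 * (s * t - 1) * (2 - s * t))"
      using True by (simp add: field_simps)
    then show ?thesis using True s by (simp add: h_def ennreal_mult')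
  next
    case False
    then have "t > 0 \<Longrightarrow> radial_cutoff (t * s) = 0"
      using s by (intro radial_cutoff_eq_0) (auto simp: mult.commute)
    moreover have "t \<le> 0 \<Longrightarrow> s * t \<le> 0"
      using s by (simp add: mult_nonneg_nonpos)
    ultimately show ?thesis
      using False by (auto simp: h_def indicator_def)
  qed
  then have "(\<integral>\<^sup>+t. indicator {0<..} t * ennreal (radial_cutoff (t * s) / t) \<partial>lborel)
     = (\<integral>\<^sup>+t. ennreal s * h (0 + s * t) \<partial>lborel)"
    by simp
  also have "\<dots> = (\<integral>\<^sup>+t. h t \<partial>lborel)"
    using nn_integral_real_affine [of h s 0] s by (simp add: nn_integral_cmult)
  also have "\<dots> = ennreal ((9 * 2\<^sup>2 - 2 * 2^3 - 12 * 2) - (9 * 1\<^sup>2 - 2 * 1^3 - 12 * 1))"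
    unfolding h_def
  proof (rule nn_integral_FTC_Icc [where F = "\<lambda>t. 9 * t\<^sup>2 - 2 * t^3 - 12 * t"])
    fix t :: real assume "t \<in> {1..2}"
    then show "0 \<le> 6 * (t - 1) * (2 - t)" by (intro mult_nonneg_nonneg) auto
  qed (auto intro!: derivative_eq_intros simp: power2_eq_square algebra_simps)
  finally show ?thesis by simp
qed

text \<open>Disintegrate over the levels \<open>t\<close> of \<open>\<xi> \<bullet> x\<close>. On
  one level \<open>\<rho>\<close> is constant and the projection to level \<open>s\<close> is a
  translation along \<open>\<xi>\<close>, which carries one hyperplane measure to the other.\<close>

lemma nn_integral_hyperplane_projection:
  fixes \<xi> :: "'a::euclidean_space"
  assumes "\<xi> \<noteq> 0" and [measurable]: "\<rho> \<in> borel_measurable borel" "F \<in> borel_measurable borel"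
  shows "(\<integral>\<^sup>+x. \<rho> (\<xi> \<bullet> x) * F (x - ((\<xi> \<bullet> x - s) / (\<xi> \<bullet> \<xi>)) *\<^sub>R \<xi>) \<partial>lborel) =
    (\<integral>\<^sup>+t. \<rho> t \<partial>lborel) * (\<integral>\<^sup>+x. F x \<partial>hyperplane_measure \<xi> s)"
proof -
  have "(\<integral>\<^sup>+x. \<rho> (\<xi> \<bullet> x) * F (x - ((\<xi> \<bullet> x - s) / (\<xi> \<bullet> \<xi>)) *\<^sub>R \<xi>) \<partial>hyperplane_measure \<xi> t) =
      \<rho> t * (\<integral>\<^sup>+x. F x \<partial>hyperplane_measure \<xi> s)" for t
  proof -
    define v where "v = ((s - t) / (\<xi> \<bullet> \<xi>)) *\<^sub>R \<xi>"
    have "(\<integral>\<^sup>+x. \<rho> (\<xi> \<bullet> x) * F (x - ((\<xi> \<bullet> x - s) / (\<xi> \<bullet> \<xi>)) *\<^sub>R \<xi>) \<partial>hyperplane_measure \<xi> t) =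
        (\<integral>\<^sup>+x. \<rho> t * F (v + x) \<partial>hyperplane_measure \<xi> t)"
    proof (rule nn_integral_cong_AE)
      have v: "x - ((t - s) / (\<xi> \<bullet> \<xi>)) *\<^sub>R \<xi> = v + x" for x
        by (simp add: v_def algebra_simps flip: scaleR_add_left add_divide_distrib diff_divide_distrib)
      show "AE x in hyperplane_measure \<xi> t.
          \<rho> (\<xi> \<bullet> x) * F (x - ((\<xi> \<bullet> x - s) / (\<xi> \<bullet> \<xi>)) *\<^sub>R \<xi>) = \<rho> t * F (v + x)"
        using AE_hyperplane_measure [OF assms(1), of t] by eventually_elim (simp add: v)
    qed
    also have "\<dots> = \<rho> t * (\<integral>\<^sup>+x. F x \<partial>distr (hyperplane_measure \<xi> t) borel (\<lambda>x. v + x))"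
      by (simp add: nn_integral_cmult nn_integral_distr)
    also have "distr (hyperplane_measure \<xi> t) borel (\<lambda>x. v + x) = hyperplane_measure \<xi> s"
      using distr_hyperplane_measure_translation [OF assms(1), of t v] assms(1) by (simp add: v_def)
    finally show ?thesis .
  qed
  then show ?thesis
    by (subst nn_integral_hyperplane_measure_disintegration [OF assms(1), symmetric])
       (simp_all add: nn_integral_multc)
qed

lemma nn_integral_lborel_scaleR:
  fixes h :: "'a::euclidean_space \<Rightarrow> ennreal"
  assumes [measurable]: "h \<in> borel_measurable borel" and "c > 0"
  shows "(\<integral>\<^sup>+x. h x \<partial>lborel) = ennreal (c ^ DIM('a)) * (\<integral>\<^sup>+x. h (c *\<^sub>R x) \<partial>lborel)"
  using assms(2)
  by (subst lborel_affine [of c 0]) (simp_all add: nn_integral_density nn_integral_distr nn_integral_cmult)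

text \<open>Dilating by \<open>t\<close> multiplies Lebesgue measure by \<open>t ^ DIM('a)\<close>
  and turns the slab of thickness \<open>1\<close> at level \<open>t\<close> into one of thickness
  \<open>1 / t\<close> at level \<open>1\<close>; the thickness enters only as a factor.\<close>

lemma nn_integral_hyperplane_measure_scale:
  fixes \<xi> :: "'a::euclidean_space"
  assumes "\<xi> \<noteq> 0" "t > 0" and [measurable]: "g \<in> borel_measurable borel"
  shows "(\<integral>\<^sup>+x. g x \<partial>hyperplane_measure \<xi> t) =
    ennreal (t ^ DIM('a) / t) * (\<integral>\<^sup>+x. g (t *\<^sub>R x) \<partial>hyperplane_measure \<xi> 1)"
proof -
  have "(\<integral>\<^sup>+x. g x \<partial>hyperplane_measure \<xi> t) = ennreal (t ^ DIM('a)) *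
    (\<integral>\<^sup>+x. indicator {t..t+1} (\<xi> \<bullet> (t *\<^sub>R x)) *
       g (t *\<^sub>R x - ((\<xi> \<bullet> (t *\<^sub>R x) - t) / (\<xi> \<bullet> \<xi>)) *\<^sub>R \<xi>) \<partial>lborel)"
    using assms(2) by (simp only: nn_integral_hyperplane_measure assms(3)) (subst nn_integral_lborel_scaleR [of _ t], simp_all)
  also have "(\<integral>\<^sup>+x. indicator {t..t+1} (\<xi> \<bullet> (t *\<^sub>R x)) *
       g (t *\<^sub>R x - ((\<xi> \<bullet> (t *\<^sub>R x) - t) / (\<xi> \<bullet> \<xi>)) *\<^sub>R \<xi>) \<partial>lborel) =
    (\<integral>\<^sup>+x. indicator {t..t+1} (t * (\<xi> \<bullet> x)) *
       g (t *\<^sub>R (x - ((\<xi> \<bullet> x - 1) / (\<xi> \<bullet> \<xi>)) *\<^sub>R \<xi>)) \<partial>lborel)"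
    by (rule nn_integral_cong) (simp add: algebra_simps diff_divide_distrib)
  also have "\<dots> = (\<integral>\<^sup>+r. indicator {t..t+1} (t * r) \<partial>lborel) * (\<integral>\<^sup>+x. g (t *\<^sub>R x) \<partial>hyperplane_measure \<xi> 1)"
    by (rule nn_integral_hyperplane_projection [where \<rho> = "\<lambda>r. indicator {t..t+1} (t * r)"
            and F = "\<lambda>x. g (t *\<^sub>R x)"]) (use assms in auto)
  also have "(\<integral>\<^sup>+r. indicator {t..t+1} (t * r) \<partial>lborel) = (\<integral>\<^sup>+r. indicator {1..1 + 1/t} r \<partial>lborel)"
    using assms(2) by (intro nn_integral_cong) (auto simp: indicator_def field_simps)
  also have "\<dots> = ennreal (1 / t)"
    using assms(2) by simp
  finally show ?thesis
    using assms(2) by (simp add: ennreal_mult' divide_inverse mult.assoc)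
qed

text \<open>The value \<open>0\<close> for \<open>\<xi> \<bullet> x \<le> 0\<close> reflects that
  the ray through such an \<open>x\<close> does not meet the hyperplane at level
  \<open>1\<close>.\<close>

definition radial_weight :: "'a::euclidean_space \<Rightarrow> 'a \<Rightarrow> real" where
  "radial_weight \<xi> x = (if \<xi> \<bullet> x > 0 then radial_cutoff (norm x) / (\<xi> \<bullet> x) ^ DIM('a) else 0)"

lemma radial_weight_nonneg: "radial_weight \<xi> x \<ge> 0"
  by (simp add: radial_weight_def radial_cutoff_nonneg)

lemma borel_measurable_radial_weight [measurable]: "radial_weight \<xi> \<in> borel_measurable borel"
  unfolding radial_weight_def by measurable

text \<open>In polar coordinates the hyperplane measure is \<open>(\<xi> \<bullet> \<omega>)\<^sup>-\<^sup>n d\<omega>\<close>; the cutoff spreads the sphere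
  over the annulus \<open>1 \<le> norm x \<le> 2\<close>.\<close>

lemma nn_integral_hyperplane_measure_radial:
  fixes \<xi> :: "'a::euclidean_space"
  assumes "\<xi> \<noteq> 0" and [measurable]: "F \<in> borel_measurable borel"
  shows "(\<integral>\<^sup>+x. F x \<partial>hyperplane_measure \<xi> 1) =
    (\<integral>\<^sup>+x. ennreal (radial_weight \<xi> x) * F (x /\<^sub>R (\<xi> \<bullet> x)) \<partial>lborel)"
proof -
  let ?\<pi> = "\<lambda>x. x - ((\<xi> \<bullet> x - 1) / (\<xi> \<bullet> \<xi>)) *\<^sub>R \<xi>"
  \<comment> \<open>Rescaling level \<open>t\<close> to level \<open>1\<close> produces
    \<open>t ^ DIM('a) / t\<close>, and the weight contributes the inverse of
    \<open>t ^ DIM('a)\<close>; only \<open>1 / t\<close> remains. The outcome is written over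
    \<open>lborel\<close> so that Fubini for Lebesgue measure applies.\<close>
  have "(\<integral>\<^sup>+x. ennreal (radial_weight \<xi> x) * F (x /\<^sub>R (\<xi> \<bullet> x)) \<partial>hyperplane_measure \<xi> t) =
    (\<integral>\<^sup>+x. indicator {1..1+1} (\<xi> \<bullet> x) *
       (indicator {0<..} t * ennreal (radial_cutoff (t * norm (?\<pi> x)) / t) * F (?\<pi> x)) \<partial>lborel)" for t
  proof (cases "t > 0")
    case True
    have "(\<integral>\<^sup>+x. ennreal (radial_weight \<xi> x) * F (x /\<^sub>R (\<xi> \<bullet> x)) \<partial>hyperplane_measure \<xi> t) =
        (\<integral>\<^sup>+x. ennreal (radial_cutoff (norm x) / t ^ DIM('a)) * F (x /\<^sub>R t) \<partial>hyperplane_measure \<xi> t)"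
      by (rule nn_integral_cong_AE)
         (use AE_hyperplane_measure [OF assms(1), of t] in eventually_elim,
           use True in \<open>simp add: radial_weight_def\<close>)
    also have "\<dots> = (\<integral>\<^sup>+x. ennreal (t ^ DIM('a) / t) * 
        (ennreal (radial_cutoff (norm (t *\<^sub>R x)) / t ^ DIM('a)) * F ((t *\<^sub>R x) /\<^sub>R t)) \<partial>hyperplane_measure \<xi> 1)"
      by (subst nn_integral_hyperplane_measure_scale) (use True assms(1) in \<open>simp_all add: nn_integral_cmult\<close>)
    also have "\<dots> = (\<integral>\<^sup>+x. indicator {0<..} t * ennreal (radial_cutoff (t * norm x) / t) * F x \<partial>hyperplane_measure \<xi> 1)"
      using True by (intro nn_integral_cong) (simp add: radial_cutoff_nonneg flip: mult.assoc ennreal_mult')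
    finally show ?thesis
      by (simp add: nn_integral_hyperplane_measure)
  next
    case False
    have "(\<integral>\<^sup>+x. ennreal (radial_weight \<xi> x) * F (x /\<^sub>R (\<xi> \<bullet> x)) \<partial>hyperplane_measure \<xi> t) =
        (\<integral>\<^sup>+x. 0 \<partial>hyperplane_measure \<xi> t)"
      by (rule nn_integral_cong_AE)
         (use AE_hyperplane_measure [OF assms(1), of t] in eventually_elim,
           use False in \<open>simp add: radial_weight_def\<close>)
    then show ?thesis using False by simp
  qed
  then have "(\<integral>\<^sup>+x. ennreal (radial_weight \<xi> x) * F (x /\<^sub>R (\<xi> \<bullet> x)) \<partial>lborel) =
    (\<integral>\<^sup>+t. (\<integral>\<^sup>+x. indicator {1..1+1} (\<xi> \<bullet> x) *
       (indicator {0<..} t * ennreal (radial_cutoff (t * norm (?\<pi> x)) / t) * F (?\<pi> x)) \<partial>lborel) \<partial>lborel)"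
    by (subst nn_integral_hyperplane_measure_disintegration [OF assms(1), symmetric]) simp_all
  also have "\<dots> = (\<integral>\<^sup>+x. (\<integral>\<^sup>+t. indicator {1..1+1} (\<xi> \<bullet> x) *
       (indicator {0<..} t * ennreal (radial_cutoff (t * norm (?\<pi> x)) / t) * F (?\<pi> x)) \<partial>lborel) \<partial>lborel)"
    by (rule lborel_pair.Fubini') measurable
  also have "\<dots> = (\<integral>\<^sup>+x. indicator {1..1+1} (\<xi> \<bullet> x) * F (?\<pi> x) \<partial>lborel)"
  proof (rule nn_integral_cong)
    fix x
    have "\<xi> \<bullet> ?\<pi> x = 1" using assms(1) by (simp add: inner_diff_right)
    then have "norm (?\<pi> x) > 0" by (metis inner_zero_right zero_less_norm_iff zero_neq_one)
    \<comment> \<open>With the point on the hyperplane fixed, the \<open>t\<close>-integral runs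
      over its positive multiples, and the cutoff has total mass \<open>1\<close> there.\<close>
    from nn_integral_radial_cutoff [OF this]
    show "(\<integral>\<^sup>+t. indicator {1..1+1} (\<xi> \<bullet> x) *
       (indicator {0<..} t * ennreal (radial_cutoff (t * norm (?\<pi> x)) / t) * F (?\<pi> x)) \<partial>lborel) =
       indicator {1..1+1} (\<xi> \<bullet> x) * F (?\<pi> x)"
      by (simp add: nn_integral_cmult nn_integral_multc)
  qed
  finally show ?thesis
    by (simp add: nn_integral_hyperplane_measure)
qed

lemma hyperplane_measure_radial:
  fixes \<xi> :: "'a::euclidean_space"
  assumes "\<xi> \<noteq> 0"
  shows "hyperplane_measure \<xi> 1 =
    distr (density lborel (\<lambda>x. ennreal (radial_weight \<xi> x))) borel (\<lambda>x. x /\<^sub>R (\<xi> \<bullet> x))"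
proof (rule measure_eqI)
  fix A assume "A \<in> sets (hyperplane_measure \<xi> 1)"
  then have [measurable]: "A \<in> sets borel" by simp
  have "emeasure (hyperplane_measure \<xi> 1) A = (\<integral>\<^sup>+x. indicator A x \<partial>hyperplane_measure \<xi> 1)"
    by simp
  also have "\<dots> = (\<integral>\<^sup>+x. ennreal (radial_weight \<xi> x) * indicator A (x /\<^sub>R (\<xi> \<bullet> x)) \<partial>lborel)"
    by (rule nn_integral_hyperplane_measure_radial [OF assms]) simp
  also have "\<dots> = (\<integral>\<^sup>+x. indicator A x
      \<partial>distr (density lborel (\<lambda>x. ennreal (radial_weight \<xi> x))) borel (\<lambda>x. x /\<^sub>R (\<xi> \<bullet> x)))"
    by (subst nn_integral_distr, simp, simp, subst nn_integral_density) simp_all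
  finally show "emeasure (hyperplane_measure \<xi> 1) A =
     emeasure (distr (density lborel (\<lambda>x. ennreal (radial_weight \<xi> x))) borel (\<lambda>x. x /\<^sub>R (\<xi> \<bullet> x))) A"
    by simp
qed simp

lemma lebesgue_integral_hyperplane_measure_radial:
  fixes f :: "'a::euclidean_space \<Rightarrow> 'b::{banach, second_countable_topology}"
  assumes "\<xi> \<noteq> 0" and [measurable]: "f \<in> borel_measurable borel"
  shows "integral\<^sup>L (hyperplane_measure \<xi> 1) f =
    (\<integral>x. radial_weight \<xi> x *\<^sub>R f (x /\<^sub>R (\<xi> \<bullet> x)) \<partial>lborel)"
  by (simp add: hyperplane_measure_radial [OF assms(1)] integral_distr integral_density radial_weight_nonneg)

section \<open>Smoothness of the transform\<close>

definition hyperplane_kernel :: "('a::euclidean_space \<Rightarrow> complex) \<Rightarrow> 'a \<Rightarrow> 'a \<Rightarrow> complex" where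
  "hyperplane_kernel f \<xi> x = radial_weight \<xi> x *\<^sub>R f (x /\<^sub>R (\<xi> \<bullet> x))"

text \<open>For \<open>\<xi> \<bullet> x > 0\<close> the first alternative says that
  \<open>x /\<^sub>R (\<xi> \<bullet> x)\<close> lies outside the ball of radius \<open>A\<close>.
  The hypothesis is an open condition on \<open>(\<xi>, x)\<close>, so the kernel vanishes before
  the denominator \<open>\<xi> \<bullet> x\<close> can reach \<open>0\<close>.\<close>

lemma hyperplane_kernel_eq_0:
  assumes "\<And>x. f x \<noteq> 0 \<Longrightarrow> norm x \<le> A" "A * (\<xi> \<bullet> x) < norm x \<or> norm x < 1"
  shows "hyperplane_kernel f \<xi> x = 0"
proof (cases "\<xi> \<bullet> x > 0 \<and> norm x \<ge> 1")
  case True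
  then have "norm (x /\<^sub>R (\<xi> \<bullet> x)) > A"
    using assms(2) by (simp add: field_simps)
  with assms(1) have "f (x /\<^sub>R (\<xi> \<bullet> x)) = 0" by fastforce
  then show ?thesis by (simp add: hyperplane_kernel_def)
next
  case False
  then show ?thesis
    by (auto simp: hyperplane_kernel_def radial_weight_def radial_cutoff_eq_0)
qed

lemma hyperplane_kernel_eq_0_outside:
  "norm x \<ge> 2 \<Longrightarrow> hyperplane_kernel f \<xi> x = 0"
  by (simp add: hyperplane_kernel_def radial_weight_def radial_cutoff_eq_0)

lemma continuous_on_hyperplane_kernel:
  fixes f :: "'a::euclidean_space \<Rightarrow> complex"
  assumes "continuous_on (- {0}) f" and "A > 0" and A: "\<And>x. f x \<noteq> 0 \<Longrightarrow> norm x \<le> A"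
  shows "continuous_on UNIV (\<lambda>p. hyperplane_kernel f (fst p) (snd p))"
proof -
  \<comment> \<open>Two open sets that cover everything: on \<open>P\<close> the kernel is given by
    a continuous formula, on \<open>Z\<close> it is \<open>0\<close>. A point with
    \<open>\<xi> \<bullet> x \<le> 0\<close> lies in \<open>Z\<close> because
    \<open>A > 0\<close>.\<close>
  define P where "P = {p :: 'a \<times> 'a. fst p \<bullet> snd p > 0}"
  define Z where "Z = {p :: 'a \<times> 'a. A * (fst p \<bullet> snd p) < norm (snd p) \<or> norm (snd p) < 1}"
  have "open P"
    unfolding P_def by (intro open_Collect_less continuous_intros)
  moreover have "open Z"
    unfolding Z_def by (intro open_Collect_disj open_Collect_less continuous_intros)
  moreover have "continuous_on P (\<lambda>p. hyperplane_kernel f (fst p) (snd p))"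
  proof -
    have "continuous_on P (\<lambda>p. (radial_cutoff (norm (snd p)) / (fst p \<bullet> snd p) ^ DIM('a)) *\<^sub>R
        f (snd p /\<^sub>R (fst p \<bullet> snd p)))"
      by (intro continuous_intros continuous_on_compose2 [OF assms(1)]) (auto simp: P_def)
    then show ?thesis
      by (rule continuous_on_eq) (simp add: P_def hyperplane_kernel_def radial_weight_def)
  qed
  moreover have "continuous_on Z (\<lambda>p. hyperplane_kernel f (fst p) (snd p))"
    by (rule continuous_on_eq [of _ "\<lambda>_. 0"])
       (use hyperplane_kernel_eq_0 [OF A] in \<open>auto simp: Z_def\<close>)
  moreover have "P \<union> Z = UNIV"
  proof -
    have "p \<in> Z" if "p \<notin> P" for p
    proof (cases "norm (snd p) < 1")
      case False
      have "A * (fst p \<bullet> snd p) \<le> 0"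
        using that assms(2) by (simp add: P_def mult_nonneg_nonpos)
      also have "0 < norm (snd p)" using False by linarith
      finally show ?thesis by (simp add: Z_def)
    qed (simp add: Z_def)
    then show ?thesis by auto
  qed
  ultimately show ?thesis
    by (metis continuous_on_open_Un)
qed

text \<open>The derivative of \<open>\<integral> f(x) \<delta>(\<xi> \<bullet> x - 1) dx\<close> in the direction \<open>v\<close> is
  \<open>\<integral> (v \<bullet> x) f(x) \<delta>'(\<xi> \<bullet> x - 1) dx\<close>; integration by parts along the Euler field removes
  the derivative of \<open>\<delta>\<close> and leaves the transform of the following function.\<close>

definition transposed_deriv :: "'a::euclidean_space \<Rightarrow> ('a \<Rightarrow> complex) \<Rightarrow> 'a \<Rightarrow> complex" where
  "transposed_deriv v f x =
     - ((v \<bullet> x) *\<^sub>R (real DIM('a) *\<^sub>R f x + frechet_derivative f (at x) x))"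

section \<open>Operations on smooth functions of bounded support\<close>

lemma C_plusE:
  assumes "f \<in> C_plus"
  obtains A where "A > 0" "\<And>x. f x \<noteq> 0 \<Longrightarrow> norm x \<le> A" "continuous_on (- {0}) f" "f 0 = 0"
proof -
  from assms have "bounded {x. f x \<noteq> 0}" by (simp add: C_plus_def)
  then obtain A where "A > 0" "\<forall>x\<in>{x. f x \<noteq> 0}. norm x \<le> A"
    using bounded_pos by metis
  then show thesis
    using assms that by (auto simp: C_plus_def smooth_on_imp_continuous_on)
qed

lemma C_plus_has_derivative:
  "f \<in> C_plus \<Longrightarrow> x \<noteq> 0 \<Longrightarrow> (f has_derivative frechet_derivative f (at x)) (at x)"
  by (auto simp: C_plus_def intro!: smooth_on_has_derivative)

text \<open>Smoothness speaks of derivatives in a fixed direction, whereas here the direction is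
  \<open>x\<close> itself; expanding it in the basis reduces to fixed directions with linear
  coefficients.\<close>

lemma smooth_on_euler:
  fixes f :: "'a::euclidean_space \<Rightarrow> complex"
  assumes "open S" "smooth_on S f"
  shows "smooth_on S (\<lambda>x. frechet_derivative f (at x) x)"
proof -
  have "smooth_on S (\<lambda>x. \<Sum>b\<in>Basis. (b \<bullet> x) *\<^sub>R frechet_derivative f (at x) b)"
    by (intro smooth_on_sum smooth_on_scaleR smooth_on_inner smooth_on_derivative assms)
  moreover have "(\<Sum>b\<in>Basis. (b \<bullet> x) *\<^sub>R frechet_derivative f (at x) b) = frechet_derivative f (at x) x"
    if "x \<in> S" for x
  proof -
    interpret bounded_linear "frechet_derivative f (at x)"
      using smooth_on_has_derivative [OF assms(2,1) that] by (rule has_derivative_bounded_linear)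
    have "frechet_derivative f (at x) x = frechet_derivative f (at x) (\<Sum>b\<in>Basis. (x \<bullet> b) *\<^sub>R b)"
      by (simp add: euclidean_representation)
    also have "\<dots> = (\<Sum>b\<in>Basis. (b \<bullet> x) *\<^sub>R frechet_derivative f (at x) b)"
      by (simp add: sum scaleR inner_commute)
    finally show ?thesis by simp
  qed
  ultimately show ?thesis by (rule smooth_on_cong [OF assms(1), rotated]) simp
qed

lemma inner_scaleR_C_plus:
  assumes "f \<in> C_plus" shows "(\<lambda>x. (v \<bullet> x) *\<^sub>R f x) \<in> C_plus"
  using assms unfolding C_plus_def
  by (auto intro!: smooth_on_scaleR smooth_on_inner elim: bounded_subset)

lemma power_inner_scaleR_C_plus:
  assumes "f \<in> C_plus" shows "(\<lambda>x. (v \<bullet> x) ^ j *\<^sub>R f x) \<in> C_plus"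
proof (induction j)
  case (Suc j)
  then show ?case using inner_scaleR_C_plus [of _ v] by (simp flip: scaleR_scaleR)
qed (use assms in simp)

lemma transposed_deriv_C_plus:
  assumes "f \<in> C_plus" shows "transposed_deriv v f \<in> C_plus"
proof -
  obtain A where A: "\<And>x. f x \<noteq> 0 \<Longrightarrow> norm x \<le> A"
    by (rule C_plusE [OF assms]) blast
  have "frechet_derivative f (at x) x = 0" if "norm x > A" for x
  proof -
    have "frechet_derivative f (at x) = frechet_derivative (\<lambda>_. 0) (at x)"
      by (rule frechet_derivative_cong_open [where S = "{x. norm x > A}"])
         (use A that in \<open>force intro!: open_Collect_less continuous_intros\<close>)+
    then show ?thesis by simp
  qed
  moreover have "f x = 0" if "norm x > A" for x using A that by force
  ultimately have "norm x \<le> A" if "transposed_deriv v f x \<noteq> 0" for x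
    using that by (cases "norm x \<le> A") (auto simp: transposed_deriv_def not_le)
  then have "bounded {x. transposed_deriv v f x \<noteq> 0}"
    by (auto simp: bounded_iff)
  moreover have "smooth_on (- {0}) (\<lambda>x. (- v \<bullet> x) *\<^sub>R (real DIM('a) *\<^sub>R f x + frechet_derivative f (at x) x))"
    using assms unfolding C_plus_def
    by (intro smooth_on_scaleR smooth_on_add smooth_on_inner smooth_on_euler smooth_on_const) auto
  ultimately show ?thesis
    by (simp add: C_plus_def transposed_deriv_def [abs_def])
qed

text \<open>Put \<open>y = x /\<^sub>R (\<xi> \<bullet> x)\<close>. In direction \<open>v\<close>
  the weight changes by \<open>- n * (v \<bullet> y)\<close> times itself and \<open>y\<close> by
  \<open>- (v \<bullet> y)\<close> times itself; the sum is the weight times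
  \<open>transposed_deriv v f y\<close>. For \<open>\<xi> \<bullet> x \<le> 0\<close> the kernel
  vanishes for all nearby \<open>\<xi>\<close>.\<close>

lemma has_derivative_hyperplane_kernel:
  fixes f :: "'a::euclidean_space \<Rightarrow> complex"
  assumes f: "f \<in> C_plus"
  shows "((\<lambda>\<xi>. hyperplane_kernel f \<xi> x) has_derivative
    (\<lambda>v. hyperplane_kernel (transposed_deriv v f) \<xi> x)) (at \<xi>)"
proof (cases "\<xi> \<bullet> x > 0")
  case True
  define y where "y = x /\<^sub>R (\<xi> \<bullet> x)"
  define n where "n = DIM('a)"
  have "x \<noteq> 0" using True by auto
  have n: "n > 0" by (simp add: n_def)
  have [simp]: "y \<noteq> 0" using True by (auto simp: y_def)
  have lin: "linear (frechet_derivative f (at y))"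
    using C_plus_has_derivative [OF f \<open>y \<noteq> 0\<close>] by (rule has_derivative_linear)
  have w: "((\<lambda>\<xi>. radial_cutoff (norm x) / (\<xi> \<bullet> x) ^ n) has_derivative
      (\<lambda>v. - (real n * (v \<bullet> y)) * (radial_cutoff (norm x) / (\<xi> \<bullet> x) ^ n))) (at \<xi>)"
  proof -
    have "(\<xi> \<bullet> x) ^ n = (\<xi> \<bullet> x) ^ (n - 1) * (\<xi> \<bullet> x)"
      using n by (metis power_minus_mult)
    then show ?thesis
      using True
      by (auto intro!: derivative_eq_intros simp: y_def field_simps)
  qed
  have "((\<lambda>\<xi>. x /\<^sub>R (\<xi> \<bullet> x)) has_derivative (\<lambda>v. (- (v \<bullet> y)) *\<^sub>R y)) (at \<xi>)"
    using True by (auto intro!: derivative_eq_intros simp: y_def field_simps)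
  moreover have "(f has_derivative frechet_derivative f (at y)) (at (x /\<^sub>R (\<xi> \<bullet> x)))"
    using C_plus_has_derivative [OF f \<open>y \<noteq> 0\<close>] by (simp add: y_def)
  ultimately have "((\<lambda>\<xi>. f (x /\<^sub>R (\<xi> \<bullet> x))) has_derivative
      (\<lambda>v. frechet_derivative f (at y) ((- (v \<bullet> y)) *\<^sub>R y))) (at \<xi>)"
    by (rule has_derivative_compose)
  then have "((\<lambda>\<xi>. f (x /\<^sub>R (\<xi> \<bullet> x))) has_derivative
      (\<lambda>v. (- (v \<bullet> y)) *\<^sub>R frechet_derivative f (at y) y)) (at \<xi>)"
    by (simp only: linear_scale [OF lin])
  from has_derivative_scaleR [OF w this]
  have "((\<lambda>\<xi>. (radial_cutoff (norm x) / (\<xi> \<bullet> x) ^ n) *\<^sub>R f (x /\<^sub>R (\<xi> \<bullet> x))) has_derivative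
     (\<lambda>v. hyperplane_kernel (transposed_deriv v f) \<xi> x)) (at \<xi>)"
    using True
    by (auto simp: hyperplane_kernel_def radial_weight_def transposed_deriv_def n_def y_def algebra_simps
       elim!: has_derivative_eq_rhs)
  then show ?thesis
    by (rule has_derivative_transform_within_open [where s = "{\<xi>. \<xi> \<bullet> x > 0}"])
       (use True in \<open>auto simp: hyperplane_kernel_def radial_weight_def n_def
          intro!: open_Collect_less continuous_intros\<close>)
next
  case False
  obtain A where A: "A > 0" "\<And>x. f x \<noteq> 0 \<Longrightarrow> norm x \<le> A"
    by (rule C_plusE [OF f]) blast
  have "((\<lambda>\<xi>. hyperplane_kernel f \<xi> x) has_derivative (\<lambda>v. 0)) (at \<xi>)"
  proof (rule has_derivative_transform_within_open [OF has_derivative_const])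
    show "open {\<xi>. A * (\<xi> \<bullet> x) < norm x \<or> norm x < 1}"
      by (intro open_Collect_disj open_Collect_less continuous_intros)
    have "A * (\<xi> \<bullet> x) \<le> 0" using False A by (simp add: mult_nonneg_nonpos)
    then show "\<xi> \<in> {\<xi>. A * (\<xi> \<bullet> x) < norm x \<or> norm x < 1}"
      by (cases "x = 0") (auto intro: le_less_trans)
    show "0 = hyperplane_kernel f \<eta> x" if "\<eta> \<in> {\<xi>. A * (\<xi> \<bullet> x) < norm x \<or> norm x < 1}" for \<eta>
      using hyperplane_kernel_eq_0 [OF A(2), of f \<eta> x] that by simp
  qed
  then show ?thesis
    using False by (simp add: hyperplane_kernel_def radial_weight_def)
qed

section \<open>Differentiation under the integral sign\<close>

abbreviation annulus_box :: "'a::euclidean_space set" where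
  "annulus_box \<equiv> cbox (- (2 *\<^sub>R One)) (2 *\<^sub>R One)"

lemma norm_ge_2_if_not_annulus_box:
  assumes "x \<notin> annulus_box" shows "norm x \<ge> 2"
proof -
  obtain b where "b \<in> Basis" "\<bar>x \<bullet> b\<bar> > 2"
    using assms by (fastforce simp: mem_box)
  then show ?thesis using Basis_le_norm [of b x] by linarith
qed

lemma continuous_on_hyperplane_kernel_C_plus:
  assumes "f \<in> C_plus" shows "continuous_on S (hyperplane_kernel f \<xi>)"
proof -
  obtain A where A: "continuous_on (- {0}) f" "A > 0" "\<And>x. f x \<noteq> 0 \<Longrightarrow> norm x \<le> A"
    by (rule C_plusE [OF assms]) blast
  show ?thesis
    using continuous_on_compose2 [OF continuous_on_hyperplane_kernel [OF A], of S "\<lambda>x. (\<xi>, x)"]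
    by (simp add: continuous_intros)
qed

lemma hyperplane_kernel_integrable_on:
  "f \<in> C_plus \<Longrightarrow> hyperplane_kernel f \<xi> integrable_on annulus_box"
  by (intro integrable_continuous continuous_on_hyperplane_kernel_C_plus)

text \<open>The domain no longer depends on \<open>\<xi>\<close>. The formula also holds at
  \<open>\<xi> = 0\<close>, where the kernel vanishes and the transform is \<open>0\<close> by
  definition.\<close>

lemma hyperplane_transform_eq_integral:
  fixes f :: "'a::euclidean_space \<Rightarrow> complex"
  assumes f: "f \<in> C_plus"
  shows "hyperplane_transform f \<xi> = integral annulus_box (hyperplane_kernel f \<xi>)"
proof (cases "\<xi> = 0")
  case True
  have "hyperplane_kernel f 0 = (\<lambda>x. 0)"
    by (auto simp: hyperplane_kernel_def radial_weight_def)
  with True show ?thesis by (simp add: hyperplane_transform_def)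
next
  case False
  have cont: "continuous_on (- {0}) f" and f0: "f 0 = 0"
    by (rule C_plusE [OF f]; blast)+
  have "(\<lambda>x. if x \<in> - {0} then f x else 0) \<in> borel_measurable borel"
    by (intro borel_measurable_continuous_on_if cont) auto
  also have "(\<lambda>x. if x \<in> - {0} then f x else 0) = f" using f0 by auto
  finally have [measurable]: "f \<in> borel_measurable borel" .
  have supp: "indicator annulus_box x *\<^sub>R hyperplane_kernel f \<xi> x = hyperplane_kernel f \<xi> x" for x
    using norm_ge_2_if_not_annulus_box [of x] hyperplane_kernel_eq_0_outside [of x f \<xi>]
    by (auto simp: indicator_def)
  have "set_integrable lborel annulus_box (hyperplane_kernel f \<xi>)"
    unfolding set_integrable_def
    by (intro borel_integrable_compact compact_cbox continuous_on_hyperplane_kernel_C_plus f)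
  from set_borel_integral_eq_integral(2) [OF this]
  have "(\<integral>x. hyperplane_kernel f \<xi> x \<partial>lborel) = integral annulus_box (hyperplane_kernel f \<xi>)"
    unfolding set_lebesgue_integral_def supp .
  then show ?thesis
    using False by (simp add: hyperplane_transform_def lebesgue_integral_hyperplane_measure_radial
        hyperplane_kernel_def [abs_def])
qed

lemma has_derivative_hyperplane_transform:
  fixes f :: "'a::euclidean_space \<Rightarrow> complex"
  assumes f: "f \<in> C_plus"
  shows "(hyperplane_transform f has_derivative
    (\<lambda>v. hyperplane_transform (transposed_deriv v f) \<xi>)) (at \<xi>)"
proof -
  \<comment> \<open>The Leibniz rule wants the derivative as a jointly continuous
    \<open>blinfun\<close>-valued map; in finite dimension its continuity can be checked for each
    direction \<open>v\<close> separately.\<close>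
  define D where "D \<xi> x = Blinfun (\<lambda>v. hyperplane_kernel (transposed_deriv v f) \<xi> x)" for \<xi> x
  have D: "blinfun_apply (D \<xi> x) = (\<lambda>v. hyperplane_kernel (transposed_deriv v f) \<xi> x)" for \<xi> x
    unfolding D_def
    by (rule bounded_linear_Blinfun_apply [OF has_derivative_bounded_linear, OF has_derivative_hyperplane_kernel [OF f]])
  have cont: "continuous_on UNIV (\<lambda>p. D (fst p) (snd p))"
  proof (rule continuous_on_blinfun_componentwise)
    fix v :: 'a
    obtain A where "continuous_on (- {0}) (transposed_deriv v f)" "A > 0"
      "\<And>x. transposed_deriv v f x \<noteq> 0 \<Longrightarrow> norm x \<le> A"
      by (rule C_plusE [OF transposed_deriv_C_plus [OF f, of v]]) blast
    then show "continuous_on UNIV (\<lambda>p. blinfun_apply (D (fst p) (snd p)) v)"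
      unfolding D by (intro continuous_on_hyperplane_kernel)
  qed
  have "((\<lambda>\<xi>. integral annulus_box (hyperplane_kernel f \<xi>)) has_derivative integral annulus_box (D \<xi>)) (at \<xi>)"
  proof (rule leibniz_rule [where U = UNIV])
    show "((\<lambda>\<xi>. hyperplane_kernel f \<xi> x) has_derivative blinfun_apply (D \<xi> x)) (at \<xi>)" for \<xi> x
      unfolding D by (rule has_derivative_hyperplane_kernel [OF f])
    show "continuous_on (UNIV \<times> annulus_box) (\<lambda>(\<xi>, x). D \<xi> x)"
      using cont by (auto simp: case_prod_unfold intro: continuous_on_subset)
  qed (use hyperplane_kernel_integrable_on [OF f] in auto)
  moreover have "D \<xi> integrable_on annulus_box"
    using continuous_on_compose2 [OF cont, of annulus_box "\<lambda>x. (\<xi>, x)"]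
    by (intro integrable_continuous) (simp add: continuous_intros)
  then have "blinfun_apply (integral annulus_box (D \<xi>)) =
      (\<lambda>v. hyperplane_transform (transposed_deriv v f) \<xi>)"
    by (simp add: fun_eq_iff blinfun_apply_integral D hyperplane_transform_eq_integral transposed_deriv_C_plus f)
  ultimately show ?thesis
    by (simp add: hyperplane_transform_eq_integral [OF f, abs_def])
qed

text \<open>A directional derivative of the transform is the transform of
  \<open>transposed_deriv v f\<close>, again in \<open>C_plus\<close>, so the induction runs over
  all \<open>f\<close> at once.\<close>

lemma smooth_on_hyperplane_transform:
  assumes "open S" "f \<in> C_plus" shows "smooth_on S (hyperplane_transform f)"
  unfolding smooth_on_def
proof
  fix k
  show "Ck_on k S (hyperplane_transform f)"
    using assms(2)
  proof (induction k arbitrary: f)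
    case 0
    then have "continuous (at \<xi>) (hyperplane_transform f)" for \<xi>
      using has_derivative_hyperplane_transform has_derivative_continuous by blast
    then show ?case by (simp add: continuous_at_imp_continuous_on)
  next
    case (Suc k)
    show ?case
      by (rule Ck_on_SucI [OF assms(1) has_derivative_hyperplane_transform [OF Suc.prems]])
         (intro Suc.IH transposed_deriv_C_plus Suc.prems)
  qed
qed

text \<open>The hyperplane \<open>\<xi> \<bullet> x = 1\<close> has distance
  \<open>1 / norm \<xi>\<close> from the origin, so for \<open>norm \<xi> < 1 / A\<close> it misses
  the ball of radius \<open>A\<close> that contains the support.\<close>

lemma hyperplane_transform_eq_0_near_0:
  assumes "f \<in> C_plus"
  obtains r where "r > 0" "\<And>\<xi>. norm \<xi> < r \<Longrightarrow> hyperplane_transform f \<xi> = 0"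
proof -
  obtain A where A: "A > 0" "\<And>x. f x \<noteq> 0 \<Longrightarrow> norm x \<le> A"
    by (rule C_plusE [OF assms]) blast
  have "hyperplane_kernel f \<xi> x = 0" if "norm \<xi> < 1 / A" for \<xi> x
  proof (rule hyperplane_kernel_eq_0 [OF A(2)])
    have "A * norm \<xi> < 1" using that A(1) by (simp add: field_simps)
    moreover have "A * (\<xi> \<bullet> x) \<le> (A * norm \<xi>) * norm x"
      using A(1) norm_cauchy_schwarz [of \<xi> x] by simp
    moreover have "A * norm \<xi> * norm x < 1 * norm x" if "norm x > 0"
      using that \<open>A * norm \<xi> < 1\<close> by (intro mult_strict_right_mono)
    ultimately show "A * (\<xi> \<bullet> x) < norm x \<or> norm x < 1"
      by (cases "norm x > 0") (linarith, simp)
  qed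
  then have "hyperplane_kernel f \<xi> = (\<lambda>x. 0)" if "norm \<xi> < 1 / A" for \<xi>
    using that by (simp add: fun_eq_iff)
  then have "hyperplane_transform f \<xi> = 0" if "norm \<xi> < 1 / A" for \<xi>
    using that by (simp add: hyperplane_transform_eq_integral [OF assms])
  then show thesis using A(1) by (intro that [of "1 / A"]) auto
qed

lemma hyperplane_transform_C_minus:
  assumes "f \<in> C_plus" shows "hyperplane_transform f \<in> C_minus"
proof -
  obtain r where r: "r > 0" "\<And>\<xi>. norm \<xi> < r \<Longrightarrow> hyperplane_transform f \<xi> = 0"
    by (rule hyperplane_transform_eq_0_near_0 [OF assms]) blast
  have "\<exists>U. open U \<and> 0 \<in> U \<and> (\<forall>\<xi>\<in>U. hyperplane_transform f \<xi> = 0)"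
    by (rule exI [of _ "ball 0 r"]) (use r in auto)
  moreover have "hyperplane_transform f 0 = 0" by (simp add: hyperplane_transform_def)
  ultimately show ?thesis
    using smooth_on_hyperplane_transform [OF _ assms, of "- {0}"] by (simp add: C_minus_def open_Compl)
qed

section \<open>A function outside the range\<close>

lemma tendsto_poly_times_exp_neg:
  "((\<lambda>x::real. poly p x * exp (- x)) \<longlongrightarrow> 0) at_top"
proof -
  have "((\<lambda>x. \<Sum>i\<le>degree p. coeff p i * (x ^ i / exp x)) \<longlongrightarrow> (\<Sum>i\<le>degree p. coeff p i * 0)) at_top"
    by (intro tendsto_intros tendsto_power_div_exp_0)
  then show ?thesis
    by (simp add: poly_altdef exp_minus sum_distrib_right divide_inverse mult.assoc)
qed

definition flat_bump :: "real poly \<Rightarrow> real \<Rightarrow> real" where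
  "flat_bump p t = (if t > 0 then poly p (1 / t) * exp (- (1 / t)) else 0)"

text \<open>Functions \<open>p(1/t) exp(-1/t)\<close> are closed under differentiation: the chain
  rule gives \<open>1/t^2\<close> times \<open>p - p'\<close> at \<open>1/t\<close>, hence the
  factor \<open>[:0, 0, 1:]\<close>. At \<open>0\<close> the right difference quotient is again of
  this form, with polynomial \<open>pCons 0 p\<close>, and tends to \<open>0\<close>.\<close>

lemma DERIV_flat_bump:
  "(flat_bump p has_real_derivative flat_bump ([:0, 0, 1:] * (p - pderiv p)) t) (at t)"
proof -
  consider "t > 0" | "t < 0" | "t = 0" by linarith
  then show ?thesis
  proof cases
    case 1
    then have "((\<lambda>t. poly p (1 / t) * exp (- (1 / t))) has_real_derivative
        flat_bump ([:0, 0, 1:] * (p - pderiv p)) t) (at t)"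
      by (auto intro!: derivative_eq_intros poly_DERIV [THEN DERIV_chain2]
          simp: flat_bump_def field_simps power2_eq_square)
    then show ?thesis
      by (rule has_field_derivative_transform_within_open [where S = "{0<..}"])
         (use 1 in \<open>auto simp: flat_bump_def\<close>)
  next
    case 2
    have "((\<lambda>t. 0) has_real_derivative 0) (at t)" by simp
    then have "(flat_bump p has_real_derivative 0) (at t)"
      by (rule has_field_derivative_transform_within_open [where S = "{..<0}"])
         (use 2 in \<open>auto simp: flat_bump_def\<close>)
    then show ?thesis using 2 by (simp add: flat_bump_def)
  next
    case 3
    have "((\<lambda>h. flat_bump p h / h) \<longlongrightarrow> 0) (at_right 0)"
    proof -
      have "((\<lambda>h. poly (pCons 0 p) (inverse h) * exp (- inverse h)) \<longlongrightarrow> 0) (at_right 0)"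
        by (rule filterlim_compose [OF tendsto_poly_times_exp_neg filterlim_inverse_at_top_right])
      moreover have "\<forall>\<^sub>F h in at_right 0. poly (pCons 0 p) (inverse h) * exp (- inverse h) = flat_bump p h / h"
        by (auto simp: eventually_at_filter flat_bump_def field_simps intro!: always_eventually)
      ultimately show ?thesis by (rule Lim_transform_eventually)
    qed
    moreover have "((\<lambda>h. flat_bump p h / h) \<longlongrightarrow> 0) (at_left 0)"
      by (rule tendsto_eventually) (auto simp: eventually_at_filter flat_bump_def intro!: always_eventually)
    ultimately have "((\<lambda>h. flat_bump p h / h) \<longlongrightarrow> 0) (at 0)"
      by (simp add: filterlim_at_split)
    then show ?thesis using 3 by (simp add: DERIV_def flat_bump_def)
  qed
qed

definition flat_tower :: "nat \<Rightarrow> real \<Rightarrow> real" where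
  "flat_tower k t = flat_bump (((\<lambda>p. [:0, 0, 1:] * (p - pderiv p)) ^^ k) 1) (t - 1)"

lemma DERIV_flat_tower: "(flat_tower k has_real_derivative flat_tower (Suc k) t) (at t)"
  using DERIV_flat_bump [of "((\<lambda>p. [:0, 0, 1:] * (p - pderiv p)) ^^ k) 1" "t - 1"]
    DERIV_shift [of "flat_bump (((\<lambda>p. [:0, 0, 1:] * (p - pderiv p)) ^^ k) 1)" _ t "- 1"]
  by (simp add: flat_tower_def [abs_def])

lemma flat_tower_0: "flat_tower 0 t = (if t > 1 then exp (- (1 / (t - 1))) else 0)"
  by (simp add: flat_tower_def flat_bump_def)

text \<open>The \<open>k\<close>-th derivative of \<open>exp (- n) * cos (n^2 * t + pi / 4)\<close>:
  each differentiation brings out \<open>n^2\<close> and advances the phase by a quarter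
  period.\<close>

definition wave_tower_term :: "nat \<Rightarrow> nat \<Rightarrow> real \<Rightarrow> real" where
  "wave_tower_term k n t =
     real n ^ (2 * k) * exp (- real n) * cos (real n ^ 2 * t + pi / 4 + real k * pi / 2)"

text \<open>A smooth function whose derivatives at \<open>0\<close> exceed \<open>k! R\<^sup>k\<close> for every \<open>R\<close>; the phase
  \<open>\<pi>/4\<close> keeps both parities of \<open>k\<close> away from zero.\<close>

definition wave_tower :: "nat \<Rightarrow> real \<Rightarrow> real" where
  "wave_tower k t = (\<Sum>n. wave_tower_term k n t)"

lemma summable_power_times_exp_neg: "summable (\<lambda>n. real n ^ k * exp (- real n))"
proof (rule summable_comparison_test_ev)
  show "summable (\<lambda>n. inverse (real n ^ 2))"
    by (rule inverse_power_summable) simp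
  have "(\<lambda>n. real n ^ (k + 2) / exp (real n)) \<longlonglongrightarrow> 0"
    by (rule filterlim_compose [OF tendsto_power_div_exp_0 filterlim_real_sequentially])
  then have "\<forall>\<^sub>F n in sequentially. real n ^ (k + 2) / exp (real n) < 1"
    by (rule order_tendstoD) simp
  with eventually_gt_at_top [of 0]
  show "\<forall>\<^sub>F n in sequentially. norm (real n ^ k * exp (- real n)) \<le> inverse (real n ^ 2)"
    by eventually_elim (simp add: exp_minus field_simps power_add power2_eq_square)
qed

lemma norm_wave_tower_term_le: "norm (wave_tower_term k n t) \<le> real n ^ (2 * k) * exp (- real n)"
  by (simp add: wave_tower_term_def abs_mult mult_left_le)

lemma summable_wave_tower_term: "summable (\<lambda>n. wave_tower_term k n t)"
  by (rule summable_comparison_test [OF _ summable_power_times_exp_neg])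
     (use norm_wave_tower_term_le in blast)

lemma DERIV_wave_tower: "(wave_tower k has_real_derivative wave_tower (Suc k) t) (at t)"
  unfolding wave_tower_def [abs_def]
proof (rule has_field_derivative_series'(2) [where S = UNIV and ?x0.0 = 0 and
      f = "wave_tower_term k" and f' = "wave_tower_term (Suc k)"])
  fix n t
  have "- sin x = cos (x + pi / 2)" for x :: real
    by (simp add: cos_add)
  from this [of "real n ^ 2 * t + pi / 4 + real k * pi / 2"]
  have s: "- sin (real n ^ 2 * t + pi / 4 + real k * pi / 2) =
      cos (real n ^ 2 * t + pi / 4 + real (Suc k) * pi / 2)"
    by (simp add: add_divide_distrib distrib_right add.assoc add.commute)
  have "((\<lambda>t. wave_tower_term k n t) has_real_derivative
      real n ^ (2 * k) * exp (- real n) * (- sin (real n ^ 2 * t + pi / 4 + real k * pi / 2) * real n ^ 2)) (at t)"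
    unfolding wave_tower_term_def by (auto intro!: derivative_eq_intros)
  then show "(wave_tower_term k n has_real_derivative wave_tower_term (Suc k) n t) (at t within UNIV)"
    unfolding s by (simp add: wave_tower_term_def [abs_def] power2_eq_square mult_ac)
qed (use summable_wave_tower_term [of k 0] in
      \<open>auto intro!: Weierstrass_m_test' [OF norm_wave_tower_term_le summable_power_times_exp_neg]\<close>)

text \<open>At \<open>0\<close> all terms share one cosine factor \<open>c\<close>, so nothing
  cancels; the remaining series has nonnegative terms and is at least its term with
  \<open>n = k\<close>.\<close>

lemma abs_wave_tower_at_0_ge:
  "\<bar>wave_tower k 0\<bar> \<ge> (real k ^ k) ^ 2 * exp (- real k) / 2"
proof -
  define c where "c = cos (pi / 4 + real k * pi / 2)"
  \<comment> \<open>The doubled angle is an odd multiple of \<open>pi / 2\<close>, so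
    \<open>c\<close> squared is \<open>1 / 2\<close> for every \<open>k\<close>.\<close>
  have "2 * c\<^sup>2 - 1 = cos (2 * (pi / 4 + real k * pi / 2))"
    unfolding c_def by (rule cos_double_cos [symmetric])
  also have "2 * (pi / 4 + real k * pi / 2) = pi / 2 + pi * real k" by (simp add: field_simps)
  also have "cos \<dots> = 0" by (simp add: cos_add)
  finally have "c\<^sup>2 = 1 / 2" by simp
  moreover have "c\<^sup>2 \<le> \<bar>c\<bar>"
    using mult_left_le [of "\<bar>c\<bar>" "\<bar>c\<bar>"] by (simp add: c_def flip: power2_eq_square)
  ultimately have c: "1 / 2 \<le> \<bar>c\<bar>" by simp
  let ?a = "\<lambda>n. real n ^ (2 * k) * exp (- real n)"
  have "wave_tower k 0 = (\<Sum>n. ?a n * c)"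
    by (simp add: wave_tower_def wave_tower_term_def c_def)
  also have "\<dots> = (\<Sum>n. ?a n) * c"
    by (rule suminf_mult2 [OF summable_power_times_exp_neg, symmetric])
  finally have "\<bar>wave_tower k 0\<bar> = \<bar>\<Sum>n. ?a n\<bar> * \<bar>c\<bar>" by (simp add: abs_mult)
  moreover have "?a k \<le> (\<Sum>n. ?a n)"
    using sum_le_suminf [OF summable_power_times_exp_neg, of "{k}" "2 * k"] by simp
  moreover have "?a k = (real k ^ k) ^ 2 * exp (- real k)"
    by (simp add: power_even_eq)
  ultimately show ?thesis
    using mult_mono [of "?a k" "\<bar>\<Sum>n. ?a n\<bar>" "1 / 2" "\<bar>c\<bar>"] c by simp
qed

section \<open>Iterated antiderivatives and growth of moments\<close>

text \<open>Vanishing near \<open>0\<close> fixes the constants of integration, so each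
  \<open>y j\<close> is nonnegative. From \<open>a\<close> onwards \<open>y j\<close> dominates the
  \<open>j\<close>-fold antiderivative of the constant \<open>c\<close> that starts from
  \<open>0\<close> at \<open>a\<close>.\<close>

lemma iterated_antiderivative_lower_bound:
  fixes y :: "nat \<Rightarrow> real \<Rightarrow> real"
  assumes deriv: "\<And>j V. j < m \<Longrightarrow> V > 0 \<Longrightarrow> (y (Suc j) has_real_derivative y j V) (at V)"
    and zero: "\<And>j. j \<le> m \<Longrightarrow> \<exists>r>0. \<forall>V. 0 < V \<and> V < r \<longrightarrow> y j V = 0"
    and nonneg: "\<And>V. V > 0 \<Longrightarrow> y 0 V \<ge> 0"
    and bound: "\<And>V. V \<ge> a \<Longrightarrow> y 0 V \<ge> c" and "a > 0"
  shows "j \<le> m \<Longrightarrow> V \<ge> a \<Longrightarrow> y j V \<ge> c * (V - a) ^ j / fact j"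
proof -
  have pos: "y j V \<ge> 0" if "j \<le> m" "V > 0" for j V
    using that
  proof (induction j arbitrary: V)
    case (Suc j)
    obtain r where r: "r > 0" "\<And>V. 0 < V \<Longrightarrow> V < r \<Longrightarrow> y (Suc j) V = 0"
      using zero [OF Suc.prems(1)] by blast
    \<comment> \<open>A point in \<open>(0, V]\<close> where \<open>y (Suc j)\<close> is known to
      vanish.\<close>
    define u where "u = min V (r / 2)"
    have u: "0 < u" "u \<le> V" "u < r" using r(1) Suc.prems by (auto simp: u_def)
    have "y (Suc j) u \<le> y (Suc j) V"
    proof (rule DERIV_nonneg_imp_nondecreasing [OF u(2)])
      fix x assume "u \<le> x" "x \<le> V"
      then show "\<exists>d. (y (Suc j) has_real_derivative d) (at x) \<and> 0 \<le> d"
        using deriv [of j x] Suc u by (intro exI [of _ "y j x"]) auto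
    qed
    then show ?case using r(2) u by simp
  qed (use nonneg in simp)
  show "y j V \<ge> c * (V - a) ^ j / fact j" if "j \<le> m" "V \<ge> a"
    using that
  proof (induction j arbitrary: V)
    case (Suc j)
    define g where "g x = y (Suc j) x - c * (x - a) ^ Suc j / fact (Suc j)" for x
    have "g a \<le> g V"
    proof (rule DERIV_nonneg_imp_nondecreasing [OF Suc.prems(2)])
      fix x assume x: "a \<le> x" "x \<le> V"
      have "((\<lambda>x. c * (x - a) ^ Suc j / fact (Suc j)) has_real_derivative
          c * (real (Suc j) * (x - a) ^ j) / fact (Suc j)) (at x)"
        by (auto intro!: derivative_eq_intros simp del: power_Suc of_nat_Suc fact_Suc)
      also have "c * (real (Suc j) * (x - a) ^ j) / fact (Suc j) = c * (x - a) ^ j / fact j"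
        unfolding fact_Suc by (simp add: mult.left_commute [of c] del: of_nat_Suc)
      finally have "(g has_real_derivative (y j x - c * (x - a) ^ j / fact j)) (at x)"
        unfolding g_def using deriv [of j x] Suc.prems x \<open>a > 0\<close> by (intro derivative_intros) auto
      then show "\<exists>d. (g has_real_derivative d) (at x) \<and> 0 \<le> d"
        using Suc.IH [of x] Suc.prems x by (intro exI conjI) auto
    qed
    moreover have "g a \<ge> 0" using pos [of "Suc j" a] Suc.prems \<open>a > 0\<close> by (simp add: g_def)
    ultimately show ?case by (simp add: g_def)
  qed (use bound in simp)
qed

text \<open>Where the weight is nonzero the kernel evaluates its function at
  \<open>x /\<^sub>R (\<xi> \<bullet> x)\<close>, a point of the hyperplane, so the relation is
  needed only there.\<close>

lemma hyperplane_transform_lincomb: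
  assumes "f \<in> C_plus" "g \<in> C_plus" "h \<in> C_plus"
    and "\<And>y. \<xi> \<bullet> y = 1 \<Longrightarrow> h y = a *\<^sub>R f y + b *\<^sub>R g y"
  shows "hyperplane_transform h \<xi> = a *\<^sub>R hyperplane_transform f \<xi> + b *\<^sub>R hyperplane_transform g \<xi>"
proof -
  have "hyperplane_kernel h \<xi> x = a *\<^sub>R hyperplane_kernel f \<xi> x + b *\<^sub>R hyperplane_kernel g \<xi> x" for x
    using assms(4) [of "x /\<^sub>R (\<xi> \<bullet> x)"]
    by (auto simp: hyperplane_kernel_def radial_weight_def algebra_simps)
  then have "hyperplane_kernel h \<xi> = (\<lambda>x. a *\<^sub>R hyperplane_kernel f \<xi> x + b *\<^sub>R hyperplane_kernel g \<xi> x)"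
    by (rule ext)
  then have "integral annulus_box (hyperplane_kernel h \<xi>) =
      integral annulus_box (\<lambda>x. a *\<^sub>R hyperplane_kernel f \<xi> x + b *\<^sub>R hyperplane_kernel g \<xi> x)"
    by simp
  also have "\<dots> = a *\<^sub>R integral annulus_box (hyperplane_kernel f \<xi>) +
      b *\<^sub>R integral annulus_box (hyperplane_kernel g \<xi>)"
    using assms by (simp add: integral_add integrable_cmul hyperplane_kernel_integrable_on)
  finally show ?thesis
    using assms by (simp add: hyperplane_transform_eq_integral)
qed

text \<open>On the support of \<open>f\<close> the factor \<open>e \<bullet> x\<close> is at most
  \<open>A\<close> in absolute value. The integral on the right does not involve \<open>m\<close>,
  so moments grow at most geometrically.\<close>

lemma norm_hyperplane_transform_moment_le:
  assumes f: "f \<in> C_plus" and e: "norm e = 1" and A: "\<And>x. f x \<noteq> 0 \<Longrightarrow> norm x \<le> A"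
  shows "norm (hyperplane_transform (\<lambda>x. (e \<bullet> x) ^ m *\<^sub>R f x) \<xi>) \<le>
    A ^ m * integral annulus_box (\<lambda>x. norm (hyperplane_kernel f \<xi> x))"
proof -
  have "norm (hyperplane_kernel (\<lambda>x. (e \<bullet> x) ^ m *\<^sub>R f x) \<xi> x) \<le> A ^ m * norm (hyperplane_kernel f \<xi> x)" for x
  proof (cases "f (x /\<^sub>R (\<xi> \<bullet> x)) = 0")
    case False
    have "\<bar>e \<bullet> (x /\<^sub>R (\<xi> \<bullet> x))\<bar> \<le> norm (x /\<^sub>R (\<xi> \<bullet> x))"
      using Cauchy_Schwarz_ineq2 [of e "x /\<^sub>R (\<xi> \<bullet> x)"] unfolding e mult_1 .
    also have "\<dots> \<le> A" by (rule A [OF False])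
    finally have "\<bar>e \<bullet> (x /\<^sub>R (\<xi> \<bullet> x))\<bar> ^ m \<le> A ^ m" by (rule power_mono) simp
    from mult_right_mono [OF this, of "norm (hyperplane_kernel f \<xi> x)"] show ?thesis
      by (simp add: hyperplane_kernel_def power_abs abs_mult mult_ac del: inner_scaleR_right)
  qed (simp add: hyperplane_kernel_def)
  then have "norm (integral annulus_box (hyperplane_kernel (\<lambda>x. (e \<bullet> x) ^ m *\<^sub>R f x) \<xi>)) \<le>
      integral annulus_box (\<lambda>x. A ^ m * norm (hyperplane_kernel f \<xi> x))"
    by (intro integral_norm_bound_integral hyperplane_kernel_integrable_on power_inner_scaleR_C_plus f
          integrable_continuous continuous_intros continuous_on_hyperplane_kernel_C_plus) auto
  then show ?thesis
    by (simp add: hyperplane_transform_eq_integral power_inner_scaleR_C_plus f)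
qed

lemma hyperplane_transform_has_vector_derivative:
  assumes "f \<in> C_plus"
  shows "((\<lambda>s. hyperplane_transform f (\<xi> + s *\<^sub>R v)) has_vector_derivative
    hyperplane_transform (transposed_deriv v f) (\<xi> + s *\<^sub>R v)) (at s)"
proof -
  have "((\<lambda>s. \<xi> + s *\<^sub>R v) has_derivative (\<lambda>h. h *\<^sub>R v)) (at s)"
    by (auto intro!: derivative_eq_intros)
  from has_derivative_compose [OF this has_derivative_hyperplane_transform [OF assms]]
  show ?thesis
    unfolding has_vector_derivative_def
    by (rule has_derivative_eq_rhs)
       (simp add: linear_scale [OF has_derivative_linear [OF has_derivative_hyperplane_transform [OF assms]]])
qed

text \<open>The power of \<open>V\<close> compensates for using \<open>e2 \<bullet> x\<close>
  instead of the slope \<open>(e2 \<bullet> x) / (e1 \<bullet> x)\<close>, which is singular at \<open>e1 \<bullet> x = 0\<close>.\<close>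

lemma moment_transform_deriv:
  assumes g: "g \<in> C_plus" and "V \<noteq> 0"
  shows "((\<lambda>V. V ^ Suc j *\<^sub>R hyperplane_transform (\<lambda>x. (e2 \<bullet> x) ^ Suc j *\<^sub>R g x) (V *\<^sub>R e1)) has_vector_derivative
     V ^ j *\<^sub>R hyperplane_transform (\<lambda>x. (e2 \<bullet> x) ^ j *\<^sub>R transposed_deriv e2 g x) (V *\<^sub>R e1)) (at V)"
proof -
  define p where "p x = (e2 \<bullet> x) ^ Suc j *\<^sub>R g x" for x
  define q where "q x = (e2 \<bullet> x) ^ j *\<^sub>R transposed_deriv e2 g x" for x
  have p: "p \<in> C_plus" unfolding p_def by (rule power_inner_scaleR_C_plus [OF g])
  have q: "q \<in> C_plus" unfolding q_def
    by (intro power_inner_scaleR_C_plus transposed_deriv_C_plus g)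
  \<comment> \<open>The Euler field multiplies the homogeneous factor
    \<open>(e2 \<bullet> x) ^ Suc j\<close> by its degree, which yields the extra term in
    \<open>p\<close>.\<close>
  have td_p: "transposed_deriv e1 p y = (e1 \<bullet> y) *\<^sub>R q y - (e1 \<bullet> y) *\<^sub>R (real (Suc j) *\<^sub>R p y)"
    if "y \<noteq> 0" for y
  proof -
    have "(p has_derivative (\<lambda>v. (e2 \<bullet> y) ^ Suc j *\<^sub>R frechet_derivative g (at y) v +
        (real (Suc j) * (e2 \<bullet> v) * (e2 \<bullet> y) ^ j) *\<^sub>R g y)) (at y)"
      unfolding p_def
      by (rule has_derivative_scaleR [OF _ C_plus_has_derivative [OF g that]])
         (auto intro!: derivative_eq_intros simp del: power_Suc of_nat_Suc)
    then have "frechet_derivative p (at y) y = (e2 \<bullet> y) ^ Suc j *\<^sub>R frechet_derivative g (at y) y +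
        (real (Suc j) * (e2 \<bullet> y) * (e2 \<bullet> y) ^ j) *\<^sub>R g y"
      by (simp add: frechet_derivative_at [symmetric])
    then show ?thesis
      by (simp add: transposed_deriv_def p_def q_def algebra_simps)
  qed
  have *: "transposed_deriv e1 p y = (1 / V) *\<^sub>R q y + (- (real (Suc j) / V)) *\<^sub>R p y"
    if "(V *\<^sub>R e1) \<bullet> y = 1" for y
  proof -
    have "e1 \<bullet> y = 1 / V" "y \<noteq> 0" using that \<open>V \<noteq> 0\<close> by (auto simp: field_simps)
    with td_p [of y] show ?thesis by (simp add: divide_inverse mult.commute)
  qed
  have td: "hyperplane_transform (transposed_deriv e1 p) (V *\<^sub>R e1) =
      (1 / V) *\<^sub>R hyperplane_transform q (V *\<^sub>R e1) +
      (- (real (Suc j) / V)) *\<^sub>R hyperplane_transform p (V *\<^sub>R e1)"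
    by (rule hyperplane_transform_lincomb) (use p q * transposed_deriv_C_plus in auto)
  have "((\<lambda>V. hyperplane_transform p (V *\<^sub>R e1)) has_vector_derivative
      hyperplane_transform (transposed_deriv e1 p) (V *\<^sub>R e1)) (at V)"
    using hyperplane_transform_has_vector_derivative [OF p, of 0] by simp
  then have "((\<lambda>V. V ^ Suc j *\<^sub>R hyperplane_transform p (V *\<^sub>R e1)) has_vector_derivative
      (V ^ Suc j *\<^sub>R hyperplane_transform (transposed_deriv e1 p) (V *\<^sub>R e1) +
       (real (Suc j) * V ^ j) *\<^sub>R hyperplane_transform p (V *\<^sub>R e1))) (at V)"
    by (intro has_vector_derivative_scaleR) (auto intro!: derivative_eq_intros simp del: power_Suc of_nat_Suc)
  also have "V ^ Suc j *\<^sub>R hyperplane_transform (transposed_deriv e1 p) (V *\<^sub>R e1) +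
       (real (Suc j) * V ^ j) *\<^sub>R hyperplane_transform p (V *\<^sub>R e1) = V ^ j *\<^sub>R hyperplane_transform q (V *\<^sub>R e1)"
  proof -
    \<comment> \<open>The derivative of \<open>V ^ Suc j\<close> cancels exactly the extra term in
      \<open>p\<close>.\<close>
    have "V ^ Suc j * (1 / V) = V ^ j" "V ^ Suc j * (- (real (Suc j) / V)) = - (real (Suc j) * V ^ j)"
      using \<open>V \<noteq> 0\<close> by (simp_all del: of_nat_Suc)
    then show ?thesis
      unfolding td scaleR_add_right scaleR_scaleR by simp
  qed
  finally show ?thesis unfolding p_def q_def .
qed

text \<open>One factor \<open>m ^ m\<close> absorbs \<open>fact m\<close>, the other absorbs
  \<open>(2 * R * exp 1) ^ m\<close> once \<open>m\<close> exceeds that base; the spare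
  \<open>2 ^ m\<close> beats \<open>K\<close>.\<close>

lemma superexponential_growth:
  fixes K R :: real
  assumes "R > 0"
  shows "\<exists>m. K * R ^ m * fact m < (real m ^ m)\<^sup>2 * exp (- real m)"
proof -
  obtain m0 where m0: "2 * R * exp 1 \<le> real m0" using real_arch_simple by blast
  obtain m1 where m1: "K < 2 ^ m1" using real_arch_pow [of 2 K] by auto
  define m where "m = max 1 (max m0 m1)"
  have "m \<ge> 1" by (simp add: m_def)
  have m: "2 * R * exp 1 \<le> real m" using m0 by (simp add: m_def)
  have "K < 2 ^ m1" by (rule m1)
  also have "(2::real) ^ m1 \<le> 2 ^ m" by (rule power_increasing) (auto simp: m_def)
  finally have "K < 2 ^ m" .
  then have "K * (R ^ m * fact m) < 2 ^ m * (R ^ m * fact m)"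
    using assms by (intro mult_strict_right_mono) auto
  also have "\<dots> = (2 * R * exp 1) ^ m * exp (- real m) * fact m"
    by (simp add: power_mult_distrib exp_minus exp_of_nat_mult [symmetric] field_simps)
  also have "\<dots> \<le> real m ^ m * exp (- real m) * real m ^ m"
  proof (intro mult_mono)
    show "(2 * R * exp 1) ^ m \<le> real m ^ m" using m assms by (intro power_mono) auto
    show "fact m \<le> real m ^ m"
      using fact_le_power [of m] by simp
  qed auto
  finally show ?thesis by (auto simp: power2_eq_square mult_ac)
qed

section \<open>The function outside the range\<close>

definition wave_packet :: "'a::euclidean_space \<Rightarrow> 'a \<Rightarrow> 'a \<Rightarrow> complex" where
  "wave_packet e1 e2 \<xi> = complex_of_real (flat_tower 0 (\<xi> \<bullet> e1) * wave_tower 0 (\<xi> \<bullet> e2))"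

lemma wave_packet_C_minus: "wave_packet e1 e2 \<in> C_minus"
proof -
  have zero: "wave_packet e1 e2 \<xi> = 0" if "\<xi> \<bullet> e1 < 1" for \<xi>
    using that by (simp add: wave_packet_def flat_tower_0)
  have "\<exists>U. open U \<and> 0 \<in> U \<and> (\<forall>\<xi>\<in>U. wave_packet e1 e2 \<xi> = 0)"
    by (rule exI [of _ "{\<xi>. \<xi> \<bullet> e1 < 1}"])
       (auto simp: zero intro!: open_Collect_less continuous_intros)
  moreover have "smooth_on (- {0}) (\<lambda>\<xi>. complex_of_real (flat_tower 0 (\<xi> \<bullet> e1) *\<^sub>R wave_tower 0 (\<xi> \<bullet> e2)))"
    by (intro smooth_on_of_real smooth_on_scaleR smooth_on_derivative_tower_inner
          DERIV_flat_tower DERIV_wave_tower) (auto simp: open_Compl)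
  ultimately show ?thesis
    using zero [of 0] by (simp add: C_minus_def wave_packet_def [abs_def])
qed

lemma wave_packet_not_hyperplane_transform:
  fixes e1 e2 :: "'a::euclidean_space"
  assumes e: "e1 \<in> Basis" "e2 \<in> Basis" "e1 \<noteq> e2" and f: "f \<in> C_plus"
  shows "hyperplane_transform f \<noteq> wave_packet e1 e2"
proof
  assume eq: "hyperplane_transform f = wave_packet e1 e2"
  have inner: "e1 \<bullet> e1 = 1" "e2 \<bullet> e2 = 1" "e1 \<bullet> e2 = 0" "e2 \<bullet> e1 = 0"
    using e by (auto simp: inner_Basis)
  \<comment> \<open>The transform of \<open>F k\<close> is the \<open>k\<close>-th derivative of the
    transform of \<open>f\<close> along \<open>e2\<close>.\<close>
  define F where "F k = (transposed_deriv e2 ^^ k) f" for k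
  have F: "F k \<in> C_plus" for k
    by (induction k) (auto simp: F_def f transposed_deriv_C_plus)
  have F_Suc: "F (Suc k) = transposed_deriv e2 (F k)" for k by (simp add: F_def)
  have MF: "hyperplane_transform (F k) (V *\<^sub>R e1 + t *\<^sub>R e2) = complex_of_real (flat_tower 0 V * wave_tower k t)"
    for k V t
  proof (induction k arbitrary: t)
    case 0
    show ?case by (simp add: F_def eq wave_packet_def inner_add_left inner)
  next
    case (Suc k)
    have "((\<lambda>t. complex_of_real (flat_tower 0 V * wave_tower k t)) has_vector_derivative
        hyperplane_transform (F (Suc k)) (V *\<^sub>R e1 + t *\<^sub>R e2)) (at t)"
      using hyperplane_transform_has_vector_derivative [OF F, of k "V *\<^sub>R e1" e2 t]
      unfolding Suc F_Suc .
    moreover have "((\<lambda>t. complex_of_real (flat_tower 0 V * wave_tower k t)) has_vector_derivative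
        complex_of_real (flat_tower 0 V * wave_tower (Suc k) t)) (at t)"
      by (intro has_vector_derivative_of_real DERIV_cmult DERIV_wave_tower)
    ultimately show ?case by (rule vector_derivative_unique_at)
  qed
  obtain A where A: "A > 0" "\<And>x. f x \<noteq> 0 \<Longrightarrow> norm x \<le> A"
    by (rule C_plusE [OF f]) blast
  define C where "C = integral annulus_box (\<lambda>x. norm (hyperplane_kernel f (3 *\<^sub>R e1) x))"
  have growth: "(real m ^ m)\<^sup>2 * exp (- real m) \<le> (2 * exp 1 * C) * (3 * A) ^ m * fact m" for m
  proof -
    define c where "c = wave_tower m 0"
    \<comment> \<open>These interpolate between the \<open>m\<close>-th \<open>e2\<close>-derivative
      of the transform (\<open>j = 0\<close>, involving \<open>F m\<close>) and the
      \<open>m\<close>-th moment of \<open>f\<close> itself (\<open>j = m\<close>); each is an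
      antiderivative of the previous one in \<open>V\<close>.\<close>
    define Z where "Z j V = V ^ j *\<^sub>R hyperplane_transform (\<lambda>x. (e2 \<bullet> x) ^ j *\<^sub>R F (m - j) x) (V *\<^sub>R e1)" for j V
    \<comment> \<open>Multiplying by \<open>c\<close> makes \<open>y 0\<close> nonnegative whatever
      the sign of the wave derivative.\<close>
    define y where "y j V = c * Re (Z j V)" for j V
    have y0: "y 0 V = c\<^sup>2 * flat_tower 0 V" for V
      using MF [of m V 0] by (simp add: y_def Z_def c_def power2_eq_square)
    \<comment> \<open>The lower bound is applied with \<open>a = 2\<close>, beyond which the flat
      factor is at least \<open>exp (- 1)\<close>, and evaluated at \<open>3\<close>, so that the
      power of \<open>V - a\<close> is \<open>1\<close>.\<close>
    have "y m 3 \<ge> c\<^sup>2 * exp (- 1) * (3 - 2) ^ m / fact m"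
    proof (rule iterated_antiderivative_lower_bound [where m = m])
      fix j V assume "j < m" "(V::real) > 0"
      then have "m - j = Suc (m - Suc j)" by simp
      then have "(Z (Suc j) has_vector_derivative Z j V) (at V)"
        using moment_transform_deriv [OF F [of "m - Suc j"], where V = V and j = j and ?e2.0 = e2 and ?e1.0 = e1] \<open>V > 0\<close>
        unfolding Z_def [abs_def] by (simp add: F_Suc del: power_Suc)
      then have "((\<lambda>V. Re (Z (Suc j) V)) has_real_derivative Re (Z j V)) (at V)"
        unfolding has_real_derivative_iff_has_vector_derivative
        by (rule bounded_linear.has_vector_derivative [OF bounded_linear_Re])
      then show "(y (Suc j) has_real_derivative y j V) (at V)"
        unfolding y_def [abs_def] by (rule DERIV_cmult)
    next
      fix j
      obtain r where r: "r > 0"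
          "\<And>\<xi>. norm \<xi> < r \<Longrightarrow> hyperplane_transform (\<lambda>x. (e2 \<bullet> x) ^ j *\<^sub>R F (m - j) x) \<xi> = 0"
        by (rule hyperplane_transform_eq_0_near_0 [OF power_inner_scaleR_C_plus [OF F, of e2 j "m - j"]]) blast
      then show "\<exists>r>0. \<forall>V. 0 < V \<and> V < r \<longrightarrow> y j V = 0"
        using e by (intro exI [of _ r]) (auto simp: y_def Z_def)
    next
      show "y 0 V \<ge> 0" for V by (simp add: y0 flat_tower_0)
    next
      fix V :: real assume "V \<ge> 2"
      then have "exp (- 1) \<le> flat_tower 0 V" by (simp add: flat_tower_0)
      then show "y 0 V \<ge> c\<^sup>2 * exp (- 1)" unfolding y0 by (intro mult_left_mono) auto
    qed auto
    also have "y m 3 \<le> \<bar>c\<bar> * \<bar>Re (Z m 3)\<bar>"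
      unfolding y_def abs_mult [symmetric] by (rule abs_ge_self)
    also have "\<dots> \<le> \<bar>c\<bar> * norm (Z m 3)"
      by (intro mult_left_mono abs_Re_le_cmod abs_ge_zero)
    also have "norm (Z m 3) = 3 ^ m * norm (hyperplane_transform (\<lambda>x. (e2 \<bullet> x) ^ m *\<^sub>R f x) (3 *\<^sub>R e1))"
      by (simp add: Z_def F_def)
    also have "\<bar>c\<bar> * \<dots> \<le> \<bar>c\<bar> * (3 ^ m * (A ^ m * C))"
      unfolding C_def using norm_hyperplane_transform_moment_le [OF f _ A(2), of e2 m] e
      by (intro mult_left_mono) auto
    \<comment> \<open>One factor \<open>\<bar>c\<bar>\<close> came from the normalization of
      \<open>y\<close>; cancelling it leaves an upper bound of the form
      \<open>K * R ^ m * fact m\<close> for \<open>\<bar>c\<bar>\<close>, against its lower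
      bound.\<close>
    finally have "\<bar>c\<bar> * (\<bar>c\<bar> * (exp (- 1) / fact m)) \<le> \<bar>c\<bar> * ((3 * A) ^ m * C)"
      by (simp add: power_mult_distrib mult.assoc power2_eq_square flip: abs_mult)
    moreover have c: "\<bar>c\<bar> \<ge> (real m ^ m)\<^sup>2 * exp (- real m) / 2"
      unfolding c_def by (rule abs_wave_tower_at_0_ge)
    moreover have "\<bar>c\<bar> > 0"
    proof (rule less_le_trans [OF _ c])
      show "0 < (real m ^ m)\<^sup>2 * exp (- real m) / 2" by (cases "m = 0") auto
    qed
    ultimately have "\<bar>c\<bar> * (exp (- 1) / fact m) \<le> (3 * A) ^ m * C"
      using mult_le_cancel_left_pos by blast
    then have "\<bar>c\<bar> \<le> (3 * A) ^ m * C * (exp 1 * fact m)"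
      by (simp add: exp_minus field_simps)
    with c show ?thesis by (simp add: mult_ac)
  qed
  obtain m where "(2 * exp 1 * C) * (3 * A) ^ m * fact m < (real m ^ m)\<^sup>2 * exp (- real m)"
    using superexponential_growth [of "3 * A" "2 * exp 1 * C"] A(1) by auto
  with growth [of m] show False by simp
qed

theorem corollary4p7p4:
  assumes "CARD('n::finite) \<ge> 2"
  shows "hyperplane_transform \<in> C_plus \<rightarrow> (C_minus :: (real ^ 'n \<Rightarrow> complex) set) \<and>
         hyperplane_transform ` C_plus \<noteq> (C_minus :: (real ^ 'n \<Rightarrow> complex) set)"
proof
  show "hyperplane_transform \<in> C_plus \<rightarrow> (C_minus :: (real ^ 'n \<Rightarrow> complex) set)"
    using hyperplane_transform_C_minus by blast
  obtain a b :: 'n where "a \<noteq> b"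
    using assms card_le_Suc0_iff_eq [of "UNIV :: 'n set"] by auto
  then have "wave_packet (axis a 1) (axis b 1) \<notin>
      (hyperplane_transform ` C_plus :: (real ^ 'n \<Rightarrow> complex) set)"
    using wave_packet_not_hyperplane_transform [of "axis a 1 :: real ^ 'n" "axis b 1"]
    by (fastforce simp: axis_eq_axis)
  then show "hyperplane_transform ` C_plus \<noteq> (C_minus :: (real ^ 'n \<Rightarrow> complex) set)"
    using wave_packet_C_minus by blast
qed

end
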